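(* Let $\alpha>\frac14$, $0<\epsilon,\delta<0.1$, let $0<\xi<2\delta\epsilon^{-2}$, let $f,g$ be the traveling wave coefficients with $f(0)=g(0)=\epsilon$, and let $\frac12<\gamma<1$. Then the solution of the (non-simplified) linearized Boussinesq equations $$\partial_t\begin{pmatrix}Z\\Q\end{pmatrix}+A\begin{pmatrix}Z\\Q\end{pmatrix}=\begin{pmatrix}f(t)\Delta_t^{-1/4}(\cos(x)\,\partial_y\Delta_t^{-3/4}Z)\\ g(t)\Delta_t^{1/4}(\cos(x)\,\partial_y\Delta_t^{-3/4}Z)\end{pmatrix}+\frac{1}{1+t^2}\begin{pmatrix}f(t)\Delta_t^{-1/4}(\cos(x)\,\partial_y\Delta_t^{1/4}Z)\\ f(t)\Delta_t^{1/4}(\cos(x)\,\partial_y\Delta_t^{-1/4}Q)\end{pmatrix}$$ at frequency $\xi$ in $y$ exhibits at most algebraic growth on the time interval $(2\xi,\delta\epsilon^{-2})$: for all $t\in(2\xi,\delta\epsilon^{-2})$ the projections away from and onto the Fourier modes $k=-1,1$ in $x$ satisfy $$\|1_{|k|\ne1}(Z,Q)(t)\|\le C_\alpha\exp(10)\sqrt{\tfrac t\xi}\;\|(Z,Q)(2\xi)\|,$$ $$\|1_{|k|=1}(Z,Q)(t)\|\le C_{\alpha,\gamma}\Big(\frac t\xi\Big)^{\gamma}\exp(10)\sqrt{\tfrac t\xi}\;\|(Z,Q)(2\xi)\|,$$ where $C_\alpha$ depends only on $\alpha$ and $C_{\alpha,\gamma}$ only on $\alpha,\gamma$.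
   Context: Domain $\mathbb{T}\times\mathbb{R}$, $\mathbb{T}=\mathbb{R}/2\pi\mathbb{Z}$. The equations decouple with respect to the frequency $\xi$ in $y$ (so $\partial_y$ acts as $i\xi$). For fixed $\xi$, $(Z_k,Q_k)_{k\in\mathbb{Z}}$ are the Fourier modes in $x$, and $\|(Z,Q)\|^2=\sum_k(|Z_k|^2+|Q_k|^2)$. Operators are Fourier multipliers, with the following symbols. $\Delta_t^s$, where $\Delta_t=\partial_x^2+(\partial_y-t\partial_x)^2$: $(k^2+(\xi-kt)^2)^s$. $L_t$: $\frac{k(\xi-kt)}{k^2+(\xi-kt)^2}$. $M_t=\partial_x\Delta_t^{-1/2}$: $\frac{k}{(k^2+(\xi-kt)^2)^{1/2}}$. Further, $$A=\begin{pmatrix}-\frac12L_t&\sqrt\alpha M_t\\-\sqrt\alpha M_t&\frac12L_t\end{pmatrix}.$$ Traveling wave coefficients: $f'=g$, $g'=-\alpha f/(1+t^2)$, $f(0)=g(0)=\epsilon$ (equivalently, $\omega=-1+f(t)\cos(x-ty)$, $\theta=\alpha y+g(t)\sin(x-ty)$ solve the nonlinear inviscid Boussinesq equations). *)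

theory Defs
  imports "HOL-Analysis.Analysis"
begin

text \<open>A function of \<open>x\<close> on the torus is represented by its sequence of Fourier modes
  (the coefficients of \<open>e\<^sup>i\<^sup>k\<^sup>x\<close>); the frequency \<open>\<xi>\<close> in \<open>y\<close> is a fixed parameter.\<close>

type_synonym modes = "int \<Rightarrow> complex"

definition multiplier :: "(int \<Rightarrow> real) \<Rightarrow> modes \<Rightarrow> modes" where
  "multiplier m u = (\<lambda>k. complex_of_real (m k) * u k)"

text \<open>Symbol of \<open>-\<Delta>\<^sub>t\<close>. It is positive for \<open>\<xi> > 0\<close>, including at \<open>k = 0\<close>, so the
  real powers below are the genuine ones.\<close>

definition lap_symbol :: "real \<Rightarrow> real \<Rightarrow> int \<Rightarrow> real" where
  "lap_symbol \<xi> t k = (real_of_int k)\<^sup>2 + (\<xi> - real_of_int k * t)\<^sup>2"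

text \<open>The operator written \<open>\<Delta>\<^sub>t\<^sup>s\<close>; by convention its symbol carries no sign.\<close>

definition lap_pow :: "real \<Rightarrow> real \<Rightarrow> real \<Rightarrow> modes \<Rightarrow> modes" where
  "lap_pow \<xi> t s = multiplier (\<lambda>k. lap_symbol \<xi> t k powr s)"

definition L_op :: "real \<Rightarrow> real \<Rightarrow> modes \<Rightarrow> modes" where
  "L_op \<xi> t = multiplier (\<lambda>k. real_of_int k * (\<xi> - real_of_int k * t) / lap_symbol \<xi> t k)"

text \<open>The symbol of \<open>M\<^sub>t\<close> is taken real, i.e. without the factor \<open>\<i>\<close> of \<open>\<partial>\<^sub>x\<close>.\<close>

definition M_op :: "real \<Rightarrow> real \<Rightarrow> modes \<Rightarrow> modes" where
  "M_op \<xi> t = multiplier (\<lambda>k. real_of_int k / lap_symbol \<xi> t k powr (1/2))"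

definition dy :: "real \<Rightarrow> modes \<Rightarrow> modes" where
  "dy \<xi> u = (\<lambda>k. \<i> * complex_of_real \<xi> * u k)"

text \<open>Multiplication by \<open>cos x = (e\<^sup>i\<^sup>x + e\<^sup>-\<^sup>i\<^sup>x)/2\<close>.\<close>

definition cos_mult :: "modes \<Rightarrow> modes" where
  "cos_mult u = (\<lambda>k. (u (k - 1) + u (k + 1)) / 2)"

definition A_Z :: "real \<Rightarrow> real \<Rightarrow> real \<Rightarrow> modes \<Rightarrow> modes \<Rightarrow> modes" where
  "A_Z \<alpha> \<xi> t Z Q = (\<lambda>k. - (1/2) * L_op \<xi> t Z k + complex_of_real (sqrt \<alpha>) * M_op \<xi> t Q k)"

definition A_Q :: "real \<Rightarrow> real \<Rightarrow> real \<Rightarrow> modes \<Rightarrow> modes \<Rightarrow> modes" where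
  "A_Q \<alpha> \<xi> t Z Q = (\<lambda>k. - complex_of_real (sqrt \<alpha>) * M_op \<xi> t Z k + (1/2) * L_op \<xi> t Q k)"

definition rhs_Z :: "real \<Rightarrow> (real \<Rightarrow> real) \<Rightarrow> real \<Rightarrow> modes \<Rightarrow> modes" where
  "rhs_Z \<xi> f t Z = (\<lambda>k.
      complex_of_real (f t) *
        lap_pow \<xi> t (-1/4) (cos_mult (dy \<xi> (lap_pow \<xi> t (-3/4) Z))) k
    + complex_of_real (1 / (1 + t\<^sup>2)) * (complex_of_real (f t) *
        lap_pow \<xi> t (-1/4) (cos_mult (dy \<xi> (lap_pow \<xi> t (1/4) Z))) k))"

definition rhs_Q :: "real \<Rightarrow> (real \<Rightarrow> real) \<Rightarrow> (real \<Rightarrow> real) \<Rightarrow> real \<Rightarrow> modes \<Rightarrow> modes \<Rightarrow> modes" where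
  "rhs_Q \<xi> f g t Z Q = (\<lambda>k.
      complex_of_real (g t) *
        lap_pow \<xi> t (1/4) (cos_mult (dy \<xi> (lap_pow \<xi> t (-3/4) Z))) k
    + complex_of_real (1 / (1 + t\<^sup>2)) * (complex_of_real (f t) *
        lap_pow \<xi> t (1/4) (cos_mult (dy \<xi> (lap_pow \<xi> t (-1/4) Q))) k))"

definition finite_energy :: "modes \<Rightarrow> modes \<Rightarrow> bool" where
  "finite_energy Z Q \<longleftrightarrow> (\<lambda>k. (cmod (Z k))\<^sup>2 + (cmod (Q k))\<^sup>2) summable_on UNIV"

definition energy_norm :: "modes \<Rightarrow> modes \<Rightarrow> real" where
  "energy_norm Z Q = sqrt (\<Sum>\<^sub>\<infinity>k. (cmod (Z k))\<^sup>2 + (cmod (Q k))\<^sup>2)"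

definition proj :: "int set \<Rightarrow> modes \<Rightarrow> modes" where
  "proj K u = (\<lambda>k. if k \<in> K then u k else 0)"

text \<open>Solutions are continuous curves in \<open>\<ell>\<^sup>2\<close> satisfying the equation mode by mode. For
  \<open>\<xi> > 0\<close> all operators in the equation are bounded on \<open>\<ell>\<^sup>2\<close>, locally uniformly in \<open>t\<close> and with
  each matrix entry continuous in \<open>t\<close>; hence no regularity beyond \<open>\<ell>\<^sup>2\<close> is needed.
  Derivatives and limits are one-sided at endpoints of the time set \<open>T\<close> belonging to it.\<close>

definition linearized_boussinesq_solution ::
    "real \<Rightarrow> real \<Rightarrow> (real \<Rightarrow> real) \<Rightarrow> (real \<Rightarrow> real) \<Rightarrow> real set \<Rightarrow>
      (real \<Rightarrow> modes) \<Rightarrow> (real \<Rightarrow> modes) \<Rightarrow> bool" where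
  "linearized_boussinesq_solution \<alpha> \<xi> f g T Z Q \<longleftrightarrow>
    (\<forall>t\<in>T.
      finite_energy (Z t) (Q t) \<and>
      ((\<lambda>s. energy_norm (\<lambda>k. Z s k - Z t k) (\<lambda>k. Q s k - Q t k)) \<longlongrightarrow> 0) (at t within T) \<and>
      (\<forall>k. ((\<lambda>s. Z s k) has_vector_derivative
              (rhs_Z \<xi> f t (Z t) k - A_Z \<alpha> \<xi> t (Z t) (Q t) k)) (at t within T) \<and>
           ((\<lambda>s. Q s k) has_vector_derivative
              (rhs_Q \<xi> f g t (Z t) (Q t) k - A_Q \<alpha> \<xi> t (Z t) (Q t) k)) (at t within T)))"

definition traveling_wave_coeffs ::
    "real \<Rightarrow> real \<Rightarrow> (real \<Rightarrow> real) \<Rightarrow> (real \<Rightarrow> real) \<Rightarrow> bool" where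
  "traveling_wave_coeffs \<alpha> \<epsilon> f g \<longleftrightarrow>
    f 0 = \<epsilon> \<and> g 0 = \<epsilon> \<and>
    (\<forall>t\<ge>0. (f has_real_derivative g t) (at t within {0..}) \<and>
           (g has_real_derivative (- \<alpha> * f t / (1 + t\<^sup>2))) (at t within {0..}))"

end

theory Submission
  imports Defs
begin

text \<open>For \<open>\<alpha> > 1/4\<close> the \<open>2\<times>2\<close> system of each mode without forcing has the almost conserved
  energy \<open>|Z|\<^sup>2 + |Q|\<^sup>2 + c Re (Z Q\<^sup>*)\<close> with
  \<open>c = (kt - \<xi>) / \<surd>(\<alpha> (k\<^sup>2 + (\<xi> - kt)\<^sup>2))\<close>: the cross term cancels the leading part of its
  derivative, \<open>|c'| = O(1/(1 + t\<^sup>2))\<close> is integrable, and \<open>|c| \<le> 1/\<surd>\<alpha> < 2\<close> gives coercivity.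
  The coefficients \<open>f\<close>, \<open>g\<close> solve a system of the same form, whence
  \<open>f = O(\<epsilon> (1 + t\<^sup>2)\<^sup>1\<^sup>/\<^sup>4)\<close> and \<open>g = O(\<epsilon> (1 + t\<^sup>2)\<^sup>-\<^sup>1\<^sup>/\<^sup>4)\<close>.

  Weight the modes \<open>k \<noteq> 0\<close> by \<open>\<surd>(\<xi>/t)\<close> and the mode \<open>0\<close> by \<open>1\<close>. This balances the strong coupling
  \<open>\<epsilon> \<xi>\<^sup>-\<^sup>1\<^sup>/\<^sup>2\<close> out of the mode \<open>0\<close> against the weak coupling \<open>\<epsilon> \<xi>\<^sup>1\<^sup>/\<^sup>2 / t\<close> into it, so that for
  \<open>t \<ge> 2\<xi>\<close> all couplings become \<open>O(\<epsilon> / \<surd>t)\<close>. Up to \<open>t = \<delta> \<epsilon>\<^sup>-\<^sup>2\<close> the integral of this rate is bounded,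
  so Gronwall's inequality bounds the weighted energy, and the whole norm grows at most like
  \<open>\<surd>(t/\<xi>)\<close>, in the modes \<open>k = \<plusminus>1\<close> as well.\<close>

section \<open>Gronwall inequalities for one quantity and for chains of coupled modes\<close>

text \<open>The integrating factor \<open>exp (- R t)\<close> makes \<open>y\<close> nonincreasing.
  The rate enters through an antiderivative \<open>R\<close>, so only derivatives and no integrals
  occur; the applications supply \<open>R\<close> in closed form.\<close>

lemma gronwall_deriv:
  fixes y R r :: "real \<Rightarrow> real"
  assumes "a \<le> b"
    and y: "\<And>t. t \<in> {a..b} \<Longrightarrow> (y has_real_derivative y' t) (at t within {a..b})"
    and R: "\<And>t. t \<in> {a..b} \<Longrightarrow> (R has_real_derivative r t) (at t within {a..b})"
    and le: "\<And>t. t \<in> {a..b} \<Longrightarrow> y' t \<le> r t * y t"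
  shows "y b \<le> exp (R b - R a) * y a"
proof -
  define h where "h = (\<lambda>t. exp (- R t) * y t)"
  have h: "(h has_real_derivative exp (- R t) * (y' t - r t * y t)) (at t within {a..b})"
    if "t \<in> {a..b}" for t
    unfolding h_def
    by (auto intro!: derivative_eq_intros y[OF that] R[OF that] simp: algebra_simps)
  have "h b \<le> h a"
  proof (rule DERIV_nonpos_imp_decreasing_open[OF \<open>a \<le> b\<close>])
    fix t assume t: "a < t" "t < b"
    then have "(h has_real_derivative exp (- R t) * (y' t - r t * y t)) (at t)"
      using h[of t] by (simp add: at_within_Icc_at)
    moreover have "exp (- R t) * (y' t - r t * y t) \<le> 0"
      using le[of t] t by (simp add: mult_nonneg_nonpos)
    ultimately show "\<exists>d. (h has_real_derivative d) (at t) \<and> d \<le> 0" by blast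
  next
    show "continuous_on {a..b} h"
      by (rule DERIV_continuous_on[OF h])
  qed
  then show ?thesis
    by (simp add: h_def exp_diff exp_minus field_simps)
qed

lemma sum_int_shift:
  fixes u :: "int \<Rightarrow> real"
  shows "(\<Sum>k\<in>{-N..N}. u (k + d)) = (\<Sum>k\<in>{-N+d..N+d}. u k)"
  by (rule sum.reindex_bij_witness[of _ "\<lambda>k. k - d" "\<lambda>k. k + d"]) auto

text \<open>Cutting off infinite sums by a hat function instead of sharply makes the flux through the
  boundary \<open>O(1/N)\<close>; no uniform smallness of the tails is needed.\<close>

lemma hat_sum_shift_le:
  fixes v :: "int \<Rightarrow> real"
  assumes "N > 0" and nonneg: "\<And>k. 0 \<le> v k" and M: "\<And>A. finite A \<Longrightarrow> sum v A \<le> M"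
    and d: "\<bar>d\<bar> = 1"
  defines "\<theta> \<equiv> \<lambda>k. max 0 (1 - \<bar>real_of_int k\<bar> / real_of_int N)"
  shows "(\<Sum>k\<in>{-N..N}. \<theta> k * v (k + d)) \<le> (\<Sum>k\<in>{-N..N}. \<theta> k * v k) + M / real_of_int N"
proof -
  have lip: "\<theta> (k - d) \<le> \<theta> k + 1 / N" for k
  proof -
    have "\<bar>real_of_int k\<bar> \<le> \<bar>real_of_int (k - d)\<bar> + 1"
      using d by linarith
    then have "\<bar>real_of_int k\<bar> / N \<le> (\<bar>real_of_int (k - d)\<bar> + 1) / N"
      using \<open>N > 0\<close> by (intro divide_right_mono) auto
    moreover have "0 \<le> 1 / real_of_int N" using \<open>N > 0\<close> by simp
    ultimately show ?thesis
      unfolding \<theta>_def add_divide_distrib by linarith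
  qed
  have \<theta>0: "\<theta> k = 0" if "k \<notin> {-N..N}" for k
  proof -
    have "real_of_int \<bar>k\<bar> \<ge> real_of_int N" using that by (simp only: of_int_le_iff) auto
    then show ?thesis using \<open>N > 0\<close> by (simp add: \<theta>_def max_def field_simps)
  qed
  \<comment> \<open>Discrete summation by parts: the shift moves from \<open>v\<close> to the hat,
    which has slope at most \<open>1 / N\<close>. The index range shifts as well, but the part
    outside \<open>{-N..N}\<close> carries no weight.\<close>
  have "(\<Sum>k\<in>{-N..N}. \<theta> k * v (k + d)) = (\<Sum>k\<in>{-N+d..N+d}. \<theta> (k - d) * v k)"
    using sum_int_shift[of "\<lambda>k. \<theta> (k - d) * v k" d N] by simp
  also have "\<dots> \<le> (\<Sum>k\<in>{-N+d..N+d}. (\<theta> k + 1 / N) * v k)"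
    by (intro sum_mono mult_right_mono lip nonneg)
  also have "\<dots> = (\<Sum>k\<in>{-N+d..N+d}. \<theta> k * v k) + (\<Sum>k\<in>{-N+d..N+d}. v k) / N"
    by (simp add: distrib_right sum.distrib sum_divide_distrib)
  also have "(\<Sum>k\<in>{-N+d..N+d}. \<theta> k * v k) = (\<Sum>k\<in>{-N+d..N+d} \<inter> {-N..N}. \<theta> k * v k)"
    by (rule sum.mono_neutral_right) (use \<theta>0 in auto)
  also have "\<dots> \<le> (\<Sum>k\<in>{-N..N}. \<theta> k * v k)"
    by (rule sum_mono2) (use nonneg in \<open>auto simp: \<theta>_def\<close>)
  also have "(\<Sum>k\<in>{-N+d..N+d}. v k) / N \<le> M / N"
    using M \<open>N > 0\<close> by (intro divide_right_mono) auto
  finally show ?thesis by simp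
qed

text \<open>Summing the inequalities over all \<open>k\<close> counts each \<open>e k t\<close>
  three times, which gives the 3 in the exponent. The sums are weighted by the hat of width
  \<open>N\<close>, where moving to a neighbour costs \<open>M / N\<close>, and then
  \<open>N\<close> tends to infinity. The a priori bound \<open>M\<close> is therefore only
  qualitative and disappears from the conclusion, which involves just the initial bound
  \<open>M0\<close>.\<close>

lemma chain_gronwall:
  fixes e e' :: "int \<Rightarrow> real \<Rightarrow> real" and R r :: "real \<Rightarrow> real"
  assumes "a \<le> b"
    and nonneg: "\<And>k t. t \<in> {a..b} \<Longrightarrow> 0 \<le> e k t"
    and e: "\<And>k t. t \<in> {a..b} \<Longrightarrow> (e k has_real_derivative e' k t) (at t within {a..b})"
    and R: "\<And>t. t \<in> {a..b} \<Longrightarrow> (R has_real_derivative r t) (at t within {a..b})"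
    and r: "\<And>t. t \<in> {a..b} \<Longrightarrow> 0 \<le> r t"
    and le: "\<And>k t. t \<in> {a..b} \<Longrightarrow> e' k t \<le> r t * (e (k - 1) t + e k t + e (k + 1) t)"
    and M: "\<And>A t. finite A \<Longrightarrow> t \<in> {a..b} \<Longrightarrow> (\<Sum>k\<in>A. e k t) \<le> M"
    and M0: "\<And>A. finite A \<Longrightarrow> (\<Sum>k\<in>A. e k a) \<le> M0"
    and "finite A"
  shows "(\<Sum>k\<in>A. e k b) \<le> exp (3 * (R b - R a)) * M0"
proof -
  define \<theta> where "\<theta> = (\<lambda>N k. max 0 (1 - \<bar>real_of_int k\<bar> / real_of_int N))"
  have \<theta>: "0 \<le> \<theta> N k" "N > 0 \<Longrightarrow> \<theta> N k \<le> 1" for N k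
    by (auto simp: \<theta>_def)
  have M_nonneg: "0 \<le> M" using M[of "{}" a] \<open>a \<le> b\<close> by simp
  have step: "(\<Sum>k\<in>{-N..N}. \<theta> N k * e k b) \<le> exp (3 * (R b - R a)) * (M0 + M / N)"
    if "N > 0" for N :: int
  proof -
    \<comment> \<open>Adding \<open>M / N\<close> absorbs the two flux errors: three hat sums plus
      \<open>2 * M / N\<close> are at most \<open>3 * y t\<close>, so the differential inequality
      for \<open>y\<close> is homogeneous.\<close>
    define y where "y = (\<lambda>t. (\<Sum>k\<in>{-N..N}. \<theta> N k * e k t) + M / N)"
    have "y b \<le> exp (3 * R b - 3 * R a) * y a"
    proof (rule gronwall_deriv[OF \<open>a \<le> b\<close>])
      fix t assume t: "t \<in> {a..b}"
      show "(y has_real_derivative (\<Sum>k\<in>{-N..N}. \<theta> N k * e' k t)) (at t within {a..b})"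
        unfolding y_def by (auto intro!: derivative_eq_intros e[OF t] simp: mult.commute)
      show "((\<lambda>t. 3 * R t) has_real_derivative 3 * r t) (at t within {a..b})"
        by (auto intro!: derivative_eq_intros R[OF t])
      let ?P = "\<Sum>k\<in>{-N..N}. \<theta> N k * e k t"
      have "(\<Sum>k\<in>{-N..N}. \<theta> N k * e' k t)
          \<le> (\<Sum>k\<in>{-N..N}. \<theta> N k * (r t * (e (k + (-1)) t + e k t + e (k + 1) t)))"
        using le[OF t] by (intro sum_mono mult_left_mono \<theta>) simp
      also have "\<dots> = r t * ((\<Sum>k\<in>{-N..N}. \<theta> N k * e (k + (-1)) t) + ?P
          + (\<Sum>k\<in>{-N..N}. \<theta> N k * e (k + 1) t))"
        by (simp add: sum_distrib_left algebra_simps sum.distrib)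
      also have "\<dots> \<le> r t * ((?P + M / N) + ?P + (?P + M / N))"
        unfolding \<theta>_def
        by (intro mult_left_mono add_mono order.refl r[OF t]
            hat_sum_shift_le[OF that, where v = "\<lambda>k. e k t"] nonneg[OF t] M[OF _ t]) auto
      also have "\<dots> \<le> r t * (3 * y t)"
        using M_nonneg that 
          by (intro mult_left_mono r[OF t]) (simp add: y_def divide_right_mono)
      finally show "(\<Sum>k\<in>{-N..N}. \<theta> N k * e' k t) \<le> 3 * r t * y t" by simp
    qed
    moreover have "y a \<le> M0 + M / N"
    proof -
      have "(\<Sum>k\<in>{-N..N}. \<theta> N k * e k a) \<le> (\<Sum>k\<in>{-N..N}. 1 * e k a)"
        using \<open>a \<le> b\<close> by (intro sum_mono mult_right_mono \<theta> that nonneg) auto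
      then show ?thesis using M0[of "{-N..N}"] by (simp add: y_def)
    qed
    moreover have "(\<Sum>k\<in>{-N..N}. \<theta> N k * e k b) \<le> y b"
      using M_nonneg that by (simp add: y_def)
    ultimately show ?thesis
      by (smt (verit, best) exp_ge_zero mult_left_mono right_diff_distrib)
  qed
  obtain m :: nat where m: "A \<subseteq> {- int m..int m}"
  proof
    show "A \<subseteq> {- int (nat (Max (insert 0 (abs ` A))))..int (nat (Max (insert 0 (abs ` A))))}"
    proof
      fix k assume "k \<in> A"
      then have "\<bar>k\<bar> \<le> Max (insert 0 (abs ` A))"
        using \<open>finite A\<close> by (intro Max_ge) auto
      then show "k \<in> {- int (nat (Max (insert 0 (abs ` A))))..int (nat (Max (insert 0 (abs ` A))))}"
        by auto
    qed
  qed
  let ?S = "\<Sum>k\<in>A. e k b"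
  \<comment> \<open>On \<open>A\<close>, contained in [-m, m], the hat of width \<open>n\<close> is
    at least \<open>1 - m / n\<close>. This tends to 1, so the limit recovers the unweighted sum
    over \<open>A\<close>.\<close>
  have fin: "(1 - real m / real n) * ?S \<le> exp (3 * (R b - R a)) * (M0 + M / real n)"
    if n: "n > m" for n
  proof -
    have "(1 - real m / real n) * ?S = (\<Sum>k\<in>A. (1 - real m / real n) * e k b)"
      by (simp add: sum_distrib_left)
    also have "\<dots> \<le> (\<Sum>k\<in>A. \<theta> (int n) k * e k b)"
    proof (intro sum_mono mult_right_mono nonneg)
      fix k assume "k \<in> A"
      then have "\<bar>k\<bar> \<le> int m" using subsetD[OF m, of k] by auto
      then have "\<bar>real_of_int k\<bar> \<le> real m" by linarith
      then have "\<bar>real_of_int k\<bar> / real n \<le> real m / real n" by (rule divide_right_mono) simp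
      then show "1 - real m / real n \<le> \<theta> (int n) k" by (simp add: \<theta>_def)
    qed (use \<open>a \<le> b\<close> in auto)
    also have "\<dots> \<le> (\<Sum>k\<in>{-int n..int n}. \<theta> (int n) k * e k b)"
      using m n \<open>a \<le> b\<close> by (intro sum_mono2) (auto intro!: mult_nonneg_nonneg \<theta> nonneg)
    also have "\<dots> \<le> exp (3 * (R b - R a)) * (M0 + M / real n)"
      using step[of "int n"] n by simp
    finally show ?thesis .
  qed
  have "(\<lambda>n. (1 - real m / real n) * ?S) \<longlonglongrightarrow> (1 - 0) * ?S"
    by (intro tendsto_intros lim_const_over_n)
  moreover have "(\<lambda>n. exp (3 * (R b - R a)) * (M0 + M / real n))
      \<longlonglongrightarrow> exp (3 * (R b - R a)) * (M0 + 0)"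
    by (intro tendsto_intros lim_const_over_n)
  moreover have "\<forall>\<^sub>F n in sequentially.
      (1 - real m / real n) * ?S \<le> exp (3 * (R b - R a)) * (M0 + M / real n)"
    using fin by (auto intro: eventually_mono[OF eventually_gt_at_top[of m]])
  ultimately show ?thesis
    using tendsto_le[OF sequentially_bot] by fastforce
qed

section \<open>The energy with cross term for a 2x2 system\<close>

text \<open>The diagonal coefficient is \<open>c t * m / 2\<close> with the same \<open>c\<close> as
  in the cross term. The squares contribute c m (|Q|^2 - |Z|^2), their mixed terms cancelling each
  other, and c (Z . Q)' contributes the exact opposite; what remains is \<open>c'\<close> and the
  forcing. A general real inner product space covers both the real pair built from \<open>f\<close>,
  \<open>g\<close> and the complex Fourier modes.\<close>

lemma energy_deriv:
  fixes Z Q :: "real \<Rightarrow> 'a::real_inner" and m c' :: real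
  assumes Z: "(Z has_vector_derivative - (c t * m / 2) *\<^sub>R Z t - m *\<^sub>R Q t + F) (at t within S)"
    and Q: "(Q has_vector_derivative m *\<^sub>R Z t + (c t * m / 2) *\<^sub>R Q t + G) (at t within S)"
    and c: "(c has_real_derivative c') (at t within S)"
  shows "((\<lambda>s. (norm (Z s))\<^sup>2 + (norm (Q s))\<^sup>2 + c s * (Z s \<bullet> Q s)) has_real_derivative
    c' * (Z t \<bullet> Q t) + 2 * (Z t \<bullet> F) + 2 * (Q t \<bullet> G) + c t * (F \<bullet> Q t + Z t \<bullet> G)) (at t within S)"
proof -
  note inner = bounded_bilinear.has_vector_derivative[OF bounded_bilinear_inner,
      folded has_real_derivative_iff_has_vector_derivative]
  show ?thesis
    unfolding power2_norm_eq_inner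
    by (rule derivative_eq_intros inner[OF Z Z] inner[OF Q Q] inner[OF Z Q] c refl)+
      (simp add: algebra_simps inner_simps inner_commute)
qed

lemma energy_bounds:
  fixes z q :: "'a::real_inner" and c \<sigma> :: real
  assumes "\<bar>c\<bar> \<le> \<sigma>"
  shows "(1 - \<sigma> / 2) * ((norm z)\<^sup>2 + (norm q)\<^sup>2) \<le> (norm z)\<^sup>2 + (norm q)\<^sup>2 + c * (z \<bullet> q)"
    and "(norm z)\<^sup>2 + (norm q)\<^sup>2 + c * (z \<bullet> q) \<le> (1 + \<sigma> / 2) * ((norm z)\<^sup>2 + (norm q)\<^sup>2)"
proof -
  have "\<bar>c * (z \<bullet> q)\<bar> \<le> \<sigma> * (norm z * norm q)"
    unfolding abs_mult using assms Cauchy_Schwarz_ineq2[of z q] by (intro mult_mono) auto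
  also have "\<dots> \<le> \<sigma> * (((norm z)\<^sup>2 + (norm q)\<^sup>2) / 2)"
    using assms sum_squares_bound[of "norm z" "norm q"] by (intro mult_left_mono) auto
  finally have "\<bar>c * (z \<bullet> q)\<bar> \<le> \<sigma> / 2 * ((norm z)\<^sup>2 + (norm q)\<^sup>2)" by simp
  then show "(1 - \<sigma> / 2) * ((norm z)\<^sup>2 + (norm q)\<^sup>2) \<le> (norm z)\<^sup>2 + (norm q)\<^sup>2 + c * (z \<bullet> q)"
    "(norm z)\<^sup>2 + (norm q)\<^sup>2 + c * (z \<bullet> q) \<le> (1 + \<sigma> / 2) * ((norm z)\<^sup>2 + (norm q)\<^sup>2)"
    by (simp_all add: algebra_simps abs_le_iff)
qed


lemma one_plus_sq_pos: "0 < 1 + (t::real)\<^sup>2"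
  by (simp add: add_pos_nonneg)

text \<open>The quotient is \<sigma> times the sine of the angle of the vector (n, n s - \<xi>). In
  the quotient rule the numerator collapses by q^2 - (\<xi> - n t)^2 = n^2, leaving n^3 / q^3, which
  decays fast enough in time to be integrable.\<close>

lemma energy_angle_deriv:
  fixes n \<xi> t \<sigma> :: real
  assumes "n\<^sup>2 + (\<xi> - n * t)\<^sup>2 > 0"
  shows "((\<lambda>s. \<sigma> * (n * s - \<xi>) / sqrt (n\<^sup>2 + (\<xi> - n * s)\<^sup>2)) has_real_derivative
    \<sigma> * n ^ 3 / ((n\<^sup>2 + (\<xi> - n * t)\<^sup>2) * sqrt (n\<^sup>2 + (\<xi> - n * t)\<^sup>2))) (at t within S)"
proof -
  define q where "q = sqrt (n\<^sup>2 + (\<xi> - n * t)\<^sup>2)"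
  have q: "q > 0" "q * q = n\<^sup>2 + (\<xi> - n * t)\<^sup>2"
    using assms by (simp_all add: q_def)
  have "((\<lambda>s. \<sigma> * (n * s - \<xi>) / sqrt (n\<^sup>2 + (\<xi> - n * s)\<^sup>2)) has_real_derivative
     (\<sigma> * n * q - \<sigma> * (n * t - \<xi>) * (inverse q / 2 * (2 * (\<xi> - n * t) * (- n)))) / (q * q))
     (at t within S)"
    using q(1) assms
    by (auto intro!: derivative_eq_intros simp flip: q_def)
  also have "\<sigma> * n * q - \<sigma> * (n * t - \<xi>) * (inverse q / 2 * (2 * (\<xi> - n * t) * (- n)))
      = \<sigma> * n * (q * q - (\<xi> - n * t)\<^sup>2) / q"
    using q(1) by (simp add: field_simps power2_eq_square)
  also have "\<dots> = \<sigma> * n ^ 3 / q"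
    unfolding q(2) by (simp add: power2_eq_square power3_eq_cube mult.assoc)
  finally show ?thesis
    by (simp add: q(2) mult.commute flip: q_def)
qed

lemma energy_angle_bound:
  fixes n \<xi> t \<sigma> :: real
  assumes "\<sigma> \<ge> 0"
  shows "\<bar>\<sigma> * (n * t - \<xi>) / sqrt (n\<^sup>2 + (\<xi> - n * t)\<^sup>2)\<bar> \<le> \<sigma>"
proof -
  have "\<bar>n * t - \<xi>\<bar> \<le> sqrt (n\<^sup>2 + (\<xi> - n * t)\<^sup>2)"
    by (rule real_le_rsqrt) (simp add: power2_commute)
  then have "\<bar>n * t - \<xi>\<bar> / sqrt (n\<^sup>2 + (\<xi> - n * t)\<^sup>2) \<le> 1"
    by (metis abs_ge_zero abs_zero div_by_0 divide_le_eq_1 le_less order.trans zero_le_one)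
  then show ?thesis
    using mult_left_mono[OF _ assms, of "\<bar>n * t - \<xi>\<bar> / sqrt (n\<^sup>2 + (\<xi> - n * t)\<^sup>2)" 1] assms
    by (simp add: abs_mult)
qed

section \<open>Elementary inequalities for the coupling between neighbouring modes\<close>

text \<open>In the next three lemmas \<open>p = \<lambda>\<^sub>k\<^sup>1\<^sup>/\<^sup>4\<close>, \<open>q = \<lambda>\<^sub>l\<^sup>1\<^sup>/\<^sup>4\<close> with \<open>l = k \<plusminus> 1\<close>,
  \<open>x = (1 + t\<^sup>2)\<^sup>1\<^sup>/\<^sup>4\<close>, \<open>r = \<surd>\<xi>\<close> and \<open>\<tau> = \<surd>t\<close>; a weight of the zero mode is replaced by its value \<open>r\<close>.\<close>

lemma coupling_nonzero_modes:
  fixes p q x r \<tau> :: real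
  assumes "0 < r" "r \<le> \<tau>" "\<tau> \<le> x" "x \<le> 2 * p" "x \<le> 2 * q" "p \<le> 3 * q" "q \<le> 3 * p"
  shows "r\<^sup>2 * (x / (p * q ^ 3)) \<le> 16 / \<tau>"
    and "r\<^sup>2 * (q / (x ^ 3 * p)) \<le> 16 / \<tau>"
    and "r\<^sup>2 * (p / (x * q ^ 3)) \<le> 16 / \<tau>"
    and "r\<^sup>2 * (p / (x ^ 3 * q)) \<le> 16 / \<tau>"
proof -
  have pos: "0 < \<tau>" "0 < x" "0 < p" "0 < q" using assms by auto
  \<comment> \<open>After clearing denominators every claim rests on r^2 \<tau> \<le> x^3. The
    constant 16 is attained in the first claim, as the product of x^2 \<le> 4 p q and x^2 \<le> 4
    q^2; the others need at most 12.\<close>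
  have rx: "r\<^sup>2 * \<tau> \<le> x\<^sup>2 * x"
    using assms by (intro mult_mono power_mono) auto
  have q2: "x\<^sup>2 \<le> 4 * q\<^sup>2"
    using power_mono[OF assms(5), of 2] pos by (simp add: power_mult_distrib)
  have pq: "x\<^sup>2 \<le> 4 * (p * q)"
    using mult_mono[OF assms(4,5)] pos by (simp add: power2_eq_square)
  have "r\<^sup>2 * \<tau> * x \<le> x\<^sup>2 * x * x"
    by (rule mult_right_mono[OF rx]) (use pos in auto)
  also have "\<dots> = x\<^sup>2 * x\<^sup>2" by (simp add: power2_eq_square)
  also have "\<dots> \<le> (4 * (p * q)) * (4 * q\<^sup>2)"
    using pos by (intro mult_mono pq q2) auto
  finally show "r\<^sup>2 * (x / (p * q ^ 3)) \<le> 16 / \<tau>"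
    using pos by (simp add: field_simps power2_eq_square power3_eq_cube)
  have "r\<^sup>2 * \<tau> * q \<le> x\<^sup>2 * x * (3 * p)"
    by (intro mult_mono rx assms) (use pos in auto)
  also have "\<dots> \<le> x\<^sup>2 * x * (16 * p)"
    using pos by simp
  finally show "r\<^sup>2 * (q / (x ^ 3 * p)) \<le> 16 / \<tau>"
    using pos by (simp add: field_simps power2_eq_square power3_eq_cube)
  have "r\<^sup>2 * \<tau> * p \<le> x\<^sup>2 * x * (3 * q)"
    by (intro mult_mono rx assms) (use pos in auto)
  then have *: "r\<^sup>2 * \<tau> * p \<le> 3 * x * q * x\<^sup>2" by (simp add: mult_ac)
  also have "\<dots> \<le> 3 * x * q * (4 * q\<^sup>2)"
    by (intro mult_left_mono q2) (use pos in auto)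
  also have "\<dots> \<le> 16 * (x * q * q\<^sup>2)"
    using pos by simp
  finally show "r\<^sup>2 * (p / (x * q ^ 3)) \<le> 16 / \<tau>"
    using pos by (simp add: field_simps power2_eq_square power3_eq_cube)
  have "r\<^sup>2 * \<tau> * p \<le> 16 * x * q * x\<^sup>2"
    using * pos by (smt (verit, best) mult_right_mono zero_le_power2 mult_pos_pos)
  then show "r\<^sup>2 * (p / (x ^ 3 * q)) \<le> 16 / \<tau>"
    using pos by (simp add: field_simps power2_eq_square power3_eq_cube)
qed

lemma coupling_into_zero_mode:
  fixes q x r \<tau> :: real
  assumes "0 < r" "r \<le> \<tau>" "\<tau> \<le> x" "x \<le> 2 * q" "q \<le> 2 * x"
  shows "r\<^sup>2 * (x / (r * q ^ 3)) \<le> r / \<tau> * (16 / \<tau>)"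
    and "r\<^sup>2 * (q / (x ^ 3 * r)) \<le> r / \<tau> * (16 / \<tau>)"
    and "r\<^sup>2 * (r / (x * q ^ 3)) \<le> r / \<tau> * (16 / \<tau>)"
    and "r\<^sup>2 * (r / (x ^ 3 * q)) \<le> r / \<tau> * (16 / \<tau>)"
proof -
  have pos: "0 < \<tau>" "0 < x" "0 < q" using assms by auto
  have t2: "\<tau>\<^sup>2 \<le> x\<^sup>2" and r2: "r\<^sup>2 \<le> x\<^sup>2"
    using assms by (auto intro!: power_mono)
  have q3: "x ^ 3 \<le> 8 * q ^ 3"
    using power_mono[OF assms(4), of 3] pos by (simp add: power_mult_distrib)
  have "\<tau>\<^sup>2 * x \<le> x\<^sup>2 * x" using t2 pos by (intro mult_right_mono) auto
  also have "\<dots> = x ^ 3" by (simp add: power2_eq_square power3_eq_cube)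
  \<comment> \<open>With the common factor \<open>r\<close> cancelled, the first two claims follow
    from this inequality; the last two carry an additional r^2 and use \<open>2\<close>
    below.\<close>
  finally have 1: "\<tau>\<^sup>2 * x \<le> x ^ 3" .
  have "\<tau>\<^sup>2 * x \<le> 16 * q ^ 3" using 1 q3 pos zero_less_power[OF pos(3), of 3] by linarith
  then show "r\<^sup>2 * (x / (r * q ^ 3)) \<le> r / \<tau> * (16 / \<tau>)"
    using pos assms(1) by (simp add: field_simps power2_eq_square power3_eq_cube)
  have "\<tau>\<^sup>2 * q \<le> \<tau>\<^sup>2 * (2 * x)" by (intro mult_left_mono assms) auto
  then have "\<tau>\<^sup>2 * q \<le> 16 * x ^ 3" using 1 zero_less_power[OF pos(2), of 3] by linarith
  then show "r\<^sup>2 * (q / (x ^ 3 * r)) \<le> r / \<tau> * (16 / \<tau>)"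
    using pos assms(1) by (simp add: field_simps power2_eq_square power3_eq_cube)
  have "r\<^sup>2 * \<tau>\<^sup>2 \<le> x\<^sup>2 * x\<^sup>2" by (intro mult_mono r2 t2) auto
  also have "\<dots> = x * x ^ 3" by (simp add: power2_eq_square power3_eq_cube)
  finally have 2: "r\<^sup>2 * \<tau>\<^sup>2 \<le> x * x ^ 3" .
  also have "\<dots> \<le> x * (16 * q ^ 3)"
    using q3 zero_less_power[OF pos(3), of 3] pos(2) by (intro mult_left_mono) linarith+
  finally show "r\<^sup>2 * (r / (x * q ^ 3)) \<le> r / \<tau> * (16 / \<tau>)"
    using pos assms(1) by (simp add: field_simps power2_eq_square power3_eq_cube)
  have "r\<^sup>2 * \<tau>\<^sup>2 \<le> x ^ 3 * x" using 2 by (simp add: mult_ac)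
  also have "\<dots> \<le> x ^ 3 * (16 * q)" using pos assms(4) by (intro mult_left_mono) auto
  finally show "r\<^sup>2 * (r / (x ^ 3 * q)) \<le> r / \<tau> * (16 / \<tau>)"
    using pos assms(1) by (simp add: field_simps power2_eq_square power3_eq_cube)
qed

lemma coupling_out_of_zero_mode:
  fixes p x r \<tau> :: real
  assumes "0 < r" "r \<le> \<tau>" "\<tau> \<le> x" "x \<le> 2 * p" "p \<le> 2 * x"
  shows "r / \<tau> * (r\<^sup>2 * (x / (p * r ^ 3))) \<le> 16 / \<tau>"
    and "r / \<tau> * (r\<^sup>2 * (r / (x ^ 3 * p))) \<le> 16 / \<tau>"
    and "r / \<tau> * (r\<^sup>2 * (p / (x * r ^ 3))) \<le> 16 / \<tau>"
    and "r / \<tau> * (r\<^sup>2 * (p / (x ^ 3 * r))) \<le> 16 / \<tau>"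
proof -
  have pos: "0 < \<tau>" "0 < x" "0 < p" using assms by auto
  have r2: "r\<^sup>2 \<le> x\<^sup>2"
    using assms by (auto intro!: power_mono)
  \<comment> \<open>The critical case, together with the third claim: r * r^2 / r^3 = 1, so the
    weight \<open>r / \<tau>\<close> supplies precisely the power of \<open>r\<close> missing in the
    strong coupling out of the mode 0.\<close>
  have "x \<le> 16 * p" using assms pos by linarith
  then show "r / \<tau> * (r\<^sup>2 * (x / (p * r ^ 3))) \<le> 16 / \<tau>"
    using pos assms(1) by (simp add: field_simps power2_eq_square power3_eq_cube)
  have "r\<^sup>2 * r\<^sup>2 \<le> x\<^sup>2 * x\<^sup>2" by (intro mult_mono r2) auto
  also have "\<dots> = x ^ 3 * x" by (simp add: power2_eq_square power3_eq_cube)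
  also have "\<dots> \<le> x ^ 3 * (16 * p)" using pos assms(4) by (intro mult_left_mono) auto
  finally show "r / \<tau> * (r\<^sup>2 * (r / (x ^ 3 * p))) \<le> 16 / \<tau>"
    using pos assms(1) by (simp add: field_simps power2_eq_square power3_eq_cube)
  have "p \<le> 16 * x" using assms pos by linarith
  then show "r / \<tau> * (r\<^sup>2 * (p / (x * r ^ 3))) \<le> 16 / \<tau>"
    using pos assms(1) by (simp add: field_simps power2_eq_square power3_eq_cube)
  have "r\<^sup>2 * p \<le> x\<^sup>2 * (16 * x)"
    using pos assms(4) \<open>p \<le> 16 * x\<close> by (intro mult_mono r2) auto
  then show "r / \<tau> * (r\<^sup>2 * (p / (x ^ 3 * r))) \<le> 16 / \<tau>"
    using pos assms(1) by (simp add: field_simps power2_eq_square power3_eq_cube)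
qed

section \<open>Energy inequality and bounds for the traveling wave coefficients\<close>

lemma sqrt_gt_half:
  fixes \<alpha> :: real
  assumes "1/4 < \<alpha>"
  shows "1/2 < sqrt \<alpha>"
  using real_sqrt_less_mono[OF assms] by (simp add: real_sqrt_divide)

lemma inverse_sqrt_less_two:
  fixes \<alpha> :: real
  assumes "1/4 < \<alpha>"
  shows "1 / sqrt \<alpha> < 2"
  using sqrt_gt_half[OF assms] assms by (simp add: field_simps)

text \<open>Since |c| \<le> 2, each of the four products of \<open>z\<close>, \<open>q\<close> with
  \<open>F\<close>, \<open>G\<close> has coefficient at most 2 in absolute value, and together they
  factor into a product of sums.\<close>

lemma energy_deriv_le:
  fixes z q F G :: "'a::real_inner" and c c' :: real
  assumes "\<bar>c\<bar> \<le> 2"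
  shows "c' * (z \<bullet> q) + 2 * (z \<bullet> F) + 2 * (q \<bullet> G) + c * (F \<bullet> q + z \<bullet> G)
    \<le> \<bar>c'\<bar> / 2 * ((norm z)\<^sup>2 + (norm q)\<^sup>2) + 2 * ((norm z + norm q) * (norm F + norm G))"
proof -
  have "c' * (z \<bullet> q) \<le> \<bar>c'\<bar> * \<bar>z \<bullet> q\<bar>"
    by (metis abs_ge_self abs_mult)
  also have "\<dots> \<le> \<bar>c'\<bar> * (((norm z)\<^sup>2 + (norm q)\<^sup>2) / 2)"
    using Cauchy_Schwarz_ineq2[of z q] sum_squares_bound[of "norm z" "norm q"]
    by (intro mult_left_mono) auto
  finally have 1: "c' * (z \<bullet> q) \<le> \<bar>c'\<bar> / 2 * ((norm z)\<^sup>2 + (norm q)\<^sup>2)" by simp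
  have "c * (F \<bullet> q + z \<bullet> G) \<le> \<bar>c\<bar> * \<bar>F \<bullet> q + z \<bullet> G\<bar>"
    by (metis abs_ge_self abs_mult)
  also have "\<dots> \<le> 2 * (norm q * norm F + norm z * norm G)"
    using assms Cauchy_Schwarz_ineq2[of F q] Cauchy_Schwarz_ineq2[of z G]
    by (intro mult_mono) (auto simp: mult.commute)
  finally have 2: "c * (F \<bullet> q + z \<bullet> G) \<le> 2 * (norm q * norm F + norm z * norm G)" .
  have 3: "z \<bullet> F \<le> norm z * norm F" "q \<bullet> G \<le> norm q * norm G"
    by (rule norm_cauchy_schwarz)+
  show ?thesis
    using 1 2 3 by (simp add: algebra_simps)
qed

text \<open>The rescaled pair U = f / x, V = g x / sqrt \<alpha> with x = (1 + t^2)^(1/4) solves the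
  system of \<open>energy_deriv\<close> without forcing, so its energy stays comparable to its
  initial value. \<open>F\<close> is obtained before \<epsilon>, \<open>f\<close>, \<open>g\<close>,
  so it depends on \<alpha> alone.\<close>

lemma traveling_wave_bound:
  assumes "\<alpha> > 1/4"
  obtains F where "F > 0"
    and "\<And>\<epsilon> f g t. \<epsilon> > 0 \<Longrightarrow> traveling_wave_coeffs \<alpha> \<epsilon> f g \<Longrightarrow> t \<ge> 0 \<Longrightarrow>
      \<bar>f t\<bar> \<le> F * \<epsilon> * (1 + t\<^sup>2) powr (1/4) \<and> \<bar>g t\<bar> \<le> F * \<epsilon> / (1 + t\<^sup>2) powr (1/4)"
proof -
  define \<sigma> where "\<sigma> = 1 / sqrt \<alpha>"
  define \<kappa> where "\<kappa> = 1 - \<sigma> / 2"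
  have rt: "sqrt \<alpha> > 1/2" by (rule sqrt_gt_half[OF assms])
  have \<sigma>: "0 < \<sigma>" "\<sigma> < 2" "\<sigma> * sqrt \<alpha> = 1" "sqrt \<alpha> * sqrt \<alpha> = \<alpha>"
    using rt assms by (auto simp: \<sigma>_def field_simps)
  have \<kappa>: "\<kappa> > 0" using \<sigma> by (simp add: \<kappa>_def)
  \<comment> \<open>Squared, the factors are: the Gronwall exponential, the initial energy over
    \<epsilon>^2 (the cross term vanishes at time 0), and 1 / \<kappa> from coercivity.\<close>
  define F1 where "F1 = sqrt (exp (\<sigma> / \<kappa>) * (1 + 1 / \<alpha>) / \<kappa>)"
  have F1: "F1 > 0" using \<kappa> assms by (simp add: F1_def add_pos_pos)
  have main: "\<bar>f t\<bar> \<le> F1 * \<epsilon> * (1 + t\<^sup>2) powr (1/4) \<and>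
      \<bar>g t\<bar> \<le> sqrt \<alpha> * F1 * \<epsilon> / (1 + t\<^sup>2) powr (1/4)"
    if "\<epsilon> > 0" and fg: "traveling_wave_coeffs \<alpha> \<epsilon> f g" and "t \<ge> 0" for \<epsilon> f g t
  proof -
    define x where "x = (\<lambda>s::real. (1 + s\<^sup>2) powr (1/4))"
    define U where "U = (\<lambda>s. f s / x s)"
    define V where "V = (\<lambda>s. g s * x s / sqrt \<alpha>)"
    \<comment> \<open>This is the angle with n = -1 and \<xi> = 0, written so that
      \<open>energy_angle_deriv\<close> and \<open>energy_angle_bound\<close> match. The sign is
      negative because \<open>m\<close> below is, and \<open>c s * m / 2\<close> has to equal x' / x
      = s / (2 (1 + s^2)).\<close>
    define c where "c = (\<lambda>s. \<sigma> * (- 1 * s - 0) / sqrt ((- 1)\<^sup>2 + (0 - (- 1) * s)\<^sup>2))"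
    define E where "E = (\<lambda>s. (norm (U s))\<^sup>2 + (norm (V s))\<^sup>2 + c s * (U s \<bullet> V s))"
    have c_le: "\<bar>c s\<bar> \<le> \<sigma>" for s
      unfolding c_def by (rule energy_angle_bound) (use \<sigma> in auto)
    have x: "x s > 0" "x s * x s = sqrt (1 + s\<^sup>2)" for s
      using one_plus_sq_pos[of s] by (simp_all add: x_def powr_half_sqrt flip: powr_add)
    have x': "(x has_real_derivative s * x s / (2 * (1 + s\<^sup>2))) (at s within S)" for s S
    proof -
      have "(1 + s\<^sup>2) powr - (3 / 4) = (1 + s\<^sup>2) powr (1/4) / (1 + s\<^sup>2)"
        using powr_diff[of "1 + s\<^sup>2" "1/4" 1] one_plus_sq_pos[of s] by simp
      moreover have "(x has_real_derivative s * (1 + s\<^sup>2) powr - (3 / 4) / 2) (at s within S)"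
        unfolding x_def using one_plus_sq_pos[of s] by (auto intro!: derivative_eq_intros)
      ultimately show ?thesis by (simp add: x_def mult_ac)
    qed
    let ?d = "\<lambda>s. \<sigma> * (- 1) ^ 3 / (((- 1)\<^sup>2 + (0 - (- 1) * s)\<^sup>2) * sqrt ((- 1)\<^sup>2 + (0 - (- 1) * s)\<^sup>2))"
    have E': "(E has_real_derivative ?d s * (U s \<bullet> V s)) (at s within {0..t})" if s: "s \<in> {0..t}" for s
    proof -
      define J where "J = 1 + s\<^sup>2"
      define y where "y = x s"
      have J: "J > 0" unfolding J_def by (rule one_plus_sq_pos)
      have y: "y > 0" "sqrt J = y * y" using x[of s] by (simp_all add: y_def J_def)
      have yJ: "J = y * y * (y * y)" using J y(2) by (metis real_sqrt_mult_self abs_of_pos)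
      have f': "(f has_vector_derivative g s) (at s within {0..t})"
        and g': "(g has_vector_derivative - \<alpha> * f s / J) (at s within {0..t})"
        using fg s unfolding traveling_wave_coeffs_def J_def
        by (auto intro: has_vector_derivative_within_subset
            simp: has_real_derivative_iff_has_vector_derivative)
      note fd = f'[folded has_real_derivative_iff_has_vector_derivative]
      note gd = g'[folded has_real_derivative_iff_has_vector_derivative]
      define m where "m = - sqrt \<alpha> / sqrt J"
      have cm: "c s * m / 2 = s / (2 * J)"
        using \<sigma>(3) J y by (simp add: c_def m_def J_def[symmetric] add.commute field_simps yJ)
      have "(U has_real_derivative (g s * y - f s * (s * y / (2 * J))) / (y * y)) (at s within {0..t})"
        unfolding U_def using y(1) x'[of s "{0..t}"] fd
        by (auto intro!: derivative_eq_intros simp: y_def J_def)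
      also have "(g s * y - f s * (s * y / (2 * J))) / (y * y)
          = - (c s * m / 2) *\<^sub>R U s - m *\<^sub>R V s + 0"
        unfolding cm using y(1) rt J assms by (simp add: m_def U_def V_def y_def[symmetric] y(2) field_simps)
      finally have Ud: "(U has_vector_derivative \<dots>) (at s within {0..t})"
        by (simp add: has_real_derivative_iff_has_vector_derivative)
      have "(V has_real_derivative (- \<alpha> * f s / J * y + g s * (s * y / (2 * J))) / sqrt \<alpha>)
          (at s within {0..t})"
        unfolding V_def
        by (rule DERIV_cong[OF DERIV_cdivide[OF DERIV_mult[OF gd x']]])
          (simp add: y_def J_def mult_ac)
      also have "(- \<alpha> * f s / J * y + g s * (s * y / (2 * J))) / sqrt \<alpha>
          = m *\<^sub>R U s + (c s * m / 2) *\<^sub>R V s + 0"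
      proof -
        have "- \<alpha> * f s / J * y / sqrt \<alpha> = m * (f s / y)"
        proof -
          have "- \<alpha> * f s / J * y / sqrt \<alpha> = - (\<alpha> / sqrt \<alpha>) * f s * y / J" by simp
          also have "\<dots> = - sqrt \<alpha> * f s * y / J"
            using real_div_sqrt[of \<alpha>] assms by simp
          also have "\<dots> = m * (f s / y)"
            unfolding m_def y(2) using y(1) by (simp add: yJ field_simps)
          finally show ?thesis .
        qed
        then show ?thesis
          unfolding cm using y(1) rt J
          by (simp add: U_def V_def y_def[symmetric] add_divide_distrib diff_divide_distrib mult_ac)
      qed
      finally have Vd: "(V has_vector_derivative \<dots>) (at s within {0..t})"
        by (simp add: has_real_derivative_iff_has_vector_derivative)
      have "(c has_real_derivative ?d s) (at s within {0..t})"
        unfolding c_def by (rule energy_angle_deriv) (simp add: add_pos_nonneg)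
      from energy_deriv[OF Ud Vd this] show ?thesis
        unfolding E_def by simp
    qed
    have E_lower: "\<kappa> * ((U s)\<^sup>2 + (V s)\<^sup>2) \<le> E s" for s
      using energy_bounds(1)[OF c_le, of "U s" "V s" s] by (simp add: E_def \<kappa>_def)
    \<comment> \<open>Here |c'| \<le> \<sigma> / (1 + s^2) and coercivity divides by \<kappa>, so
      the rate has an arctan as antiderivative. From arctan t \<le> 2 the total exponent is at most
      \<sigma> / \<kappa>.\<close>
    have "E t \<le> exp (\<sigma> / (2 * \<kappa>) * arctan t - \<sigma> / (2 * \<kappa>) * arctan 0) * E 0"
    proof (rule gronwall_deriv[OF \<open>t \<ge> 0\<close> E'])
      fix s assume "s \<in> {0..t}"
      show "((\<lambda>s. \<sigma> / (2 * \<kappa>) * arctan s) has_real_derivative \<sigma> / (2 * \<kappa>) * inverse (1 + s\<^sup>2))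
          (at s within {0..t})"
        using \<kappa> by (auto intro!: derivative_eq_intros)
      have J1: "1 + s\<^sup>2 \<ge> 1" "sqrt (1 + s\<^sup>2) \<ge> 1" by simp_all
      have "?d s * (U s \<bullet> V s) \<le> \<bar>?d s\<bar> * \<bar>U s * V s\<bar>"
        by (metis abs_ge_self abs_mult inner_real_def)
      also have "\<dots> \<le> \<sigma> / (1 + s\<^sup>2) * (((U s)\<^sup>2 + (V s)\<^sup>2) / 2)"
      proof (rule mult_mono)
        have "\<bar>?d s\<bar> = \<sigma> / ((1 + s\<^sup>2) * sqrt (1 + s\<^sup>2))"
          using \<sigma> by (simp add: abs_mult)
        also have "\<dots> \<le> \<sigma> / (1 + s\<^sup>2)"
          using mult_left_mono[OF J1(2), of "1 + s\<^sup>2"] one_plus_sq_pos[of s] \<sigma>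
          by (intro divide_left_mono mult_pos_pos) simp_all
        finally show "\<bar>?d s\<bar> \<le> \<sigma> / (1 + s\<^sup>2)" .
        show "\<bar>U s * V s\<bar> \<le> ((U s)\<^sup>2 + (V s)\<^sup>2) / 2"
          using sum_squares_bound[of "\<bar>U s\<bar>" "\<bar>V s\<bar>"] by (simp add: abs_mult)
      qed (use \<sigma> J1 in auto)
      also have "\<dots> = \<sigma> / (2 * \<kappa>) * inverse (1 + s\<^sup>2) * (\<kappa> * ((U s)\<^sup>2 + (V s)\<^sup>2))"
        using \<kappa> by (simp add: inverse_eq_divide)
      also have "\<dots> \<le> \<sigma> / (2 * \<kappa>) * inverse (1 + s\<^sup>2) * E s"
        using \<kappa> J1 \<sigma> by (intro mult_left_mono E_lower) auto
      finally show "?d s * (U s \<bullet> V s) \<le> \<sigma> / (2 * \<kappa>) * inverse (1 + s\<^sup>2) * E s" .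
    qed
    also have "E 0 = \<epsilon>\<^sup>2 * (1 + 1 / \<alpha>)"
      using fg assms by (simp add: E_def U_def V_def c_def x_def traveling_wave_coeffs_def
          power_divide field_simps)
    also have "exp (\<sigma> / (2 * \<kappa>) * arctan t - \<sigma> / (2 * \<kappa>) * arctan 0) \<le> exp (\<sigma> / \<kappa>)"
    proof -
      have "arctan t \<le> 2" using arctan_ubound[of t] pi_less_4 by linarith
      then have "\<sigma> / (2 * \<kappa>) * arctan t \<le> \<sigma> / (2 * \<kappa>) * 2"
        using \<sigma> \<kappa> by (intro mult_left_mono) auto
      then show ?thesis by simp
    qed
    finally have "E t \<le> exp (\<sigma> / \<kappa>) * (\<epsilon>\<^sup>2 * (1 + 1 / \<alpha>))"
      using assms by (simp add: mult_right_mono)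
    with E_lower[of t] have "\<kappa> * ((U t)\<^sup>2 + (V t)\<^sup>2) \<le> exp (\<sigma> / \<kappa>) * (\<epsilon>\<^sup>2 * (1 + 1 / \<alpha>))"
      by linarith
    then have "(U t)\<^sup>2 + (V t)\<^sup>2 \<le> exp (\<sigma> / \<kappa>) * (1 + 1 / \<alpha>) / \<kappa> * \<epsilon>\<^sup>2"
      using \<kappa> by (simp add: field_simps)
    also have "\<dots> = (F1 * \<epsilon>)\<^sup>2"
      using \<kappa> assms by (simp add: F1_def power_mult_distrib add_nonneg_nonneg)
    finally have UV: "(U t)\<^sup>2 + (V t)\<^sup>2 \<le> (F1 * \<epsilon>)\<^sup>2" .
    have "(U t)\<^sup>2 \<le> (F1 * \<epsilon>)\<^sup>2" "(V t)\<^sup>2 \<le> (F1 * \<epsilon>)\<^sup>2"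
      using UV zero_le_power2[of "U t"] zero_le_power2[of "V t"] by linarith+
    then have "\<bar>U t\<bar> \<le> F1 * \<epsilon>" "\<bar>V t\<bar> \<le> F1 * \<epsilon>"
      using F1 \<open>\<epsilon> > 0\<close> by (auto intro!: power2_le_imp_le[where x = "\<bar>_\<bar>"])
    then have "\<bar>f t\<bar> \<le> F1 * \<epsilon> * x t \<and> \<bar>g t\<bar> \<le> sqrt \<alpha> * F1 * \<epsilon> / x t"
      using x(1)[of t] assms by (simp add: U_def V_def abs_mult field_simps)
    then show ?thesis by (simp add: x_def)
  qed
  show thesis
  proof
    \<comment> \<open>One constant dominating both \<open>F1\<close>, needed for \<open>f\<close>,
      and \<open>sqrt \<alpha> * F1\<close>, needed for \<open>g\<close>.\<close>
    show "(1 + sqrt \<alpha>) * F1 > 0" using F1 rt by simp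
    fix \<epsilon> f g and t :: real
    assume A: "\<epsilon> > 0" "traveling_wave_coeffs \<alpha> \<epsilon> f g" "t \<ge> 0"
    define x where "x = (1 + t\<^sup>2) powr (1/4)"
    have "x > 0" using one_plus_sq_pos[of t] by (simp add: x_def)
    moreover have "F1 \<le> (1 + sqrt \<alpha>) * F1" "sqrt \<alpha> * F1 \<le> (1 + sqrt \<alpha>) * F1"
      using F1 mult_pos_pos[OF F1, of "sqrt \<alpha>"] assms by (auto simp: algebra_simps)
    ultimately have "F1 * \<epsilon> * x \<le> (1 + sqrt \<alpha>) * F1 * \<epsilon> * x"
      "sqrt \<alpha> * F1 * \<epsilon> / x \<le> (1 + sqrt \<alpha>) * F1 * \<epsilon> / x"
      using A(1) F1 by (intro mult_right_mono divide_right_mono; simp)+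
    then show "\<bar>f t\<bar> \<le> (1 + sqrt \<alpha>) * F1 * \<epsilon> * (1 + t\<^sup>2) powr (1/4) \<and>
        \<bar>g t\<bar> \<le> (1 + sqrt \<alpha>) * F1 * \<epsilon> / (1 + t\<^sup>2) powr (1/4)"
      using main[OF A] unfolding x_def by linarith
  qed
qed

section \<open>Symbol estimates and the weighted forcing bound\<close>

lemma powr_quarter_le:
  fixes a b C :: real
  assumes "0 \<le> a" "0 \<le> b" "0 \<le> C" "a \<le> C ^ 4 * b"
  shows "a powr (1/4) \<le> C * b powr (1/4)"
proof (cases "C = 0")
  case False
  have "a powr (1/4) \<le> (C ^ 4 * b) powr (1/4)"
    using assms by (intro powr_mono2) auto
  also have "\<dots> = C * b powr (1/4)"
    using assms False by (simp add: powr_mult powr_powr flip: powr_numeral)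
  finally show ?thesis .
qed (use assms in auto)

text \<open>From time 2 \<xi> on, every resonance \<xi> = k t with k nonzero has passed: \<xi> is at
  most half of |k t|, so |\<xi> - k t| lies between 1/2 and 3/2 of |k t|. Squaring gives the ratios
  1/4 and 9/4.\<close>

lemma lap_symbol_bounds:
  fixes \<xi> t :: real
  assumes "0 < \<xi>" "2 * \<xi> \<le> t" "k \<noteq> 0"
  shows "(real_of_int k)\<^sup>2 * (1 + t\<^sup>2) \<le> 4 * lap_symbol \<xi> t k"
    and "4 * lap_symbol \<xi> t k \<le> 9 * ((real_of_int k)\<^sup>2 * (1 + t\<^sup>2))"
proof -
  define n where "n = real_of_int k"
  have n: "\<bar>n\<bar> \<ge> 1" using assms(3) by (simp add: n_def)
  have "\<bar>n\<bar> * t \<ge> 1 * t" using n assms by (intro mult_right_mono) auto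
  moreover have "\<bar>n * t\<bar> = \<bar>n\<bar> * t" using assms by (simp add: abs_mult)
  ultimately have \<xi>: "2 * \<xi> \<le> \<bar>n * t\<bar>" using assms by linarith
  have "\<bar>n * t\<bar> \<le> 2 * \<bar>\<xi> - n * t\<bar>" "2 * \<bar>\<xi> - n * t\<bar> \<le> 3 * \<bar>n * t\<bar>"
    using \<xi> assms(1) by (simp_all add: abs_if split: if_splits)
  from power_mono[OF this(1), of 2] power_mono[OF this(2), of 2]
  have "n\<^sup>2 * t\<^sup>2 \<le> 4 * (\<xi> - n * t)\<^sup>2" "4 * (\<xi> - n * t)\<^sup>2 \<le> 9 * (n\<^sup>2 * t\<^sup>2)"
    by (simp_all add: power_mult_distrib)
  then show "(real_of_int k)\<^sup>2 * (1 + t\<^sup>2) \<le> 4 * lap_symbol \<xi> t k"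
    "4 * lap_symbol \<xi> t k \<le> 9 * ((real_of_int k)\<^sup>2 * (1 + t\<^sup>2))"
    using zero_le_power2[of n]
    unfolding lap_symbol_def n_def[symmetric] distrib_left mult_1_right by linarith+
qed

lemma lap_symbol_pos:
  assumes "0 < \<xi>"
  shows "lap_symbol \<xi> t k > 0"
  using assms by (cases "k = 0") (auto simp: lap_symbol_def add_pos_nonneg)

lemma lap_symbol_zero_mode: "lap_symbol \<xi> t 0 = \<xi>\<^sup>2"
  by (simp add: lap_symbol_def)

definition mode_weight :: "real \<Rightarrow> real \<Rightarrow> int \<Rightarrow> real" where
  "mode_weight \<xi> t k = (if k = 0 then 1 else sqrt \<xi> / sqrt t)"

text \<open>The four expressions are the sizes of the four forcing terms acting from mode
  \<open>l\<close> on mode \<open>k\<close>, with \<open>f\<close> of size x, \<open>g\<close> of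
  size 1 / x and 1 + t^2 = x^4: first the two terms of \<open>rhs_Z\<close>, then the two of
  \<open>rhs_Q\<close>. The weight of the source mode appears on the right, which makes the estimate
  symmetric enough for \<open>chain_gronwall\<close>. The three cases (both modes nonzero, target 0,
  source 0) are the three inequalities above.\<close>

lemma coupling_bounds:
  fixes \<xi> t :: real
  assumes "0 < \<xi>" "2 * \<xi> \<le> t" "\<bar>k - l\<bar> = 1"
  defines "p \<equiv> lap_symbol \<xi> t k powr (1/4)" and "q \<equiv> lap_symbol \<xi> t l powr (1/4)"
    and "x \<equiv> (1 + t\<^sup>2) powr (1/4)"
  shows "mode_weight \<xi> t k * (\<xi> * (x / (p * q ^ 3))) \<le> mode_weight \<xi> t l * (16 / sqrt t)"
    and "mode_weight \<xi> t k * (\<xi> * (q / (x ^ 3 * p))) \<le> mode_weight \<xi> t l * (16 / sqrt t)"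
    and "mode_weight \<xi> t k * (\<xi> * (p / (x * q ^ 3))) \<le> mode_weight \<xi> t l * (16 / sqrt t)"
    and "mode_weight \<xi> t k * (\<xi> * (p / (x ^ 3 * q))) \<le> mode_weight \<xi> t l * (16 / sqrt t)"
proof -
  define r \<tau> where "r = sqrt \<xi>" and "\<tau> = sqrt t"
  have r: "0 < r" "r \<le> \<tau>" "\<xi> = r\<^sup>2" using assms by (auto simp: r_def \<tau>_def)
  have "\<tau> = (t\<^sup>2) powr (1/4)"
    using assms by (simp add: \<tau>_def powr_powr powr_half_sqrt flip: powr_numeral)
  also have "\<dots> \<le> x" unfolding x_def by (intro powr_mono2) auto
  finally have \<tau>: "\<tau> \<le> x" .
  have zero: "lap_symbol \<xi> t 0 powr (1/4) = r"
    using assms by (simp add: lap_symbol_zero_mode r_def powr_powr powr_half_sqrt flip: powr_numeral)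
  have low: "x \<le> 2 * lap_symbol \<xi> t j powr (1/4)" if "j \<noteq> 0" for j
    unfolding x_def
  proof (rule powr_quarter_le)
    have "1 \<le> \<bar>real_of_int j\<bar>" using that by simp
    then have "1 \<le> (real_of_int j)\<^sup>2" using power_mono[of 1 "\<bar>real_of_int j\<bar>" 2] by simp
    then have "1 * (1 + t\<^sup>2) \<le> (real_of_int j)\<^sup>2 * (1 + t\<^sup>2)"
      by (intro mult_right_mono) auto
    also have "\<dots> \<le> 4 * lap_symbol \<xi> t j" by (rule lap_symbol_bounds[OF assms(1,2) that])
    finally show "1 + t\<^sup>2 \<le> 2 ^ 4 * lap_symbol \<xi> t j"
      using lap_symbol_pos[OF assms(1), of t j] by simp
  qed (use lap_symbol_pos[OF assms(1), of t j] in auto)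
  have high: "lap_symbol \<xi> t j powr (1/4) \<le> 2 * x" if "\<bar>j\<bar> = 1" for j
    unfolding x_def
  proof (rule powr_quarter_le)
    have j: "(real_of_int j)\<^sup>2 = 1" "j \<noteq> 0"
      using that by (auto simp: abs_if split: if_splits)
    show "lap_symbol \<xi> t j \<le> 2 ^ 4 * (1 + t\<^sup>2)"
      using lap_symbol_bounds(2)[OF assms(1,2) j(2)] unfolding j(1)
      using one_plus_sq_pos[of t] by simp
  qed (use lap_symbol_pos[OF assms(1), of t j] in auto)
  have ratio: "lap_symbol \<xi> t i powr (1/4) \<le> 3 * lap_symbol \<xi> t j powr (1/4)"
    if "\<bar>i - j\<bar> = 1" "i \<noteq> 0" "j \<noteq> 0" for i j
  proof (rule powr_quarter_le)
    \<comment> \<open>Nonzero neighbours differ at most by a factor 2, so the symbols differ at most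
      by 9 * 4 = 36, which is below 3^4.\<close>
    have "\<bar>i\<bar> \<le> 2 * \<bar>j\<bar>" using that by linarith
    then have "\<bar>real_of_int i\<bar> \<le> 2 * \<bar>real_of_int j\<bar>" by linarith
    from power_mono[OF this, of 2] have "(real_of_int i)\<^sup>2 \<le> 4 * (real_of_int j)\<^sup>2"
      by (simp add: power_mult_distrib)
    then have "(real_of_int i)\<^sup>2 * (1 + t\<^sup>2) \<le> 4 * (real_of_int j)\<^sup>2 * (1 + t\<^sup>2)"
      by (intro mult_right_mono) auto
    then show "lap_symbol \<xi> t i \<le> 3 ^ 4 * lap_symbol \<xi> t j"
      using lap_symbol_bounds(2)[OF assms(1,2) that(2)] lap_symbol_bounds(1)[OF assms(1,2) that(3)]
        lap_symbol_pos[OF assms(1), of t j] by simp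
  qed (use lap_symbol_pos[OF assms(1)] in \<open>auto simp: less_imp_le\<close>)
  consider "k \<noteq> 0" "l \<noteq> 0" | "k = 0" "\<bar>l\<bar> = 1" | "l = 0" "\<bar>k\<bar> = 1"
    using assms(3) by linarith
  then have "mode_weight \<xi> t k * (r\<^sup>2 * (x / (p * q ^ 3))) \<le> mode_weight \<xi> t l * (16 / \<tau>) \<and>
    mode_weight \<xi> t k * (r\<^sup>2 * (q / (x ^ 3 * p))) \<le> mode_weight \<xi> t l * (16 / \<tau>) \<and>
    mode_weight \<xi> t k * (r\<^sup>2 * (p / (x * q ^ 3))) \<le> mode_weight \<xi> t l * (16 / \<tau>) \<and>
    mode_weight \<xi> t k * (r\<^sup>2 * (p / (x ^ 3 * q))) \<le> mode_weight \<xi> t l * (16 / \<tau>)"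
  proof cases
    case 1
    have "p \<le> 3 * q" "q \<le> 3 * p" "x \<le> 2 * p" "x \<le> 2 * q"
      unfolding p_def q_def using assms(3) 1 by (auto intro!: ratio low)
    note bounds = coupling_nonzero_modes[OF r(1,2) \<tau> this(3,4,1,2)]
    have w: "mode_weight \<xi> t k = r / \<tau>" "mode_weight \<xi> t l = r / \<tau>" "0 \<le> r / \<tau>"
      using 1 r(1,2) by (auto simp: mode_weight_def r_def \<tau>_def)
    show ?thesis
      unfolding w(1,2) by (intro conjI mult_left_mono bounds w(3))
  next
    case 2
    have "x \<le> 2 * q" "q \<le> 2 * x"
      unfolding q_def using 2 by (auto intro!: low high)
    note bounds = coupling_into_zero_mode[OF r(1,2) \<tau> this]
    have w: "mode_weight \<xi> t k = 1" "mode_weight \<xi> t l = r / \<tau>" "p = r"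
      using 2 zero by (auto simp: mode_weight_def r_def \<tau>_def p_def)
    show ?thesis
      unfolding w mult_1_left by (intro conjI bounds)
  next
    case 3
    have "x \<le> 2 * p" "p \<le> 2 * x"
      unfolding p_def using 3 by (auto intro!: low high)
    note bounds = coupling_out_of_zero_mode[OF r(1,2) \<tau> this]
    have w: "mode_weight \<xi> t l = 1" "mode_weight \<xi> t k = r / \<tau>" "q = r"
      using 3 zero by (auto simp: mode_weight_def r_def \<tau>_def q_def)
    show ?thesis
      unfolding w mult_1_left by (intro conjI bounds)
  qed
  then show "mode_weight \<xi> t k * (\<xi> * (x / (p * q ^ 3))) \<le> mode_weight \<xi> t l * (16 / sqrt t)"
    "mode_weight \<xi> t k * (\<xi> * (q / (x ^ 3 * p))) \<le> mode_weight \<xi> t l * (16 / sqrt t)"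
    "mode_weight \<xi> t k * (\<xi> * (p / (x * q ^ 3))) \<le> mode_weight \<xi> t l * (16 / sqrt t)"
    "mode_weight \<xi> t k * (\<xi> * (p / (x ^ 3 * q))) \<le> mode_weight \<xi> t l * (16 / sqrt t)"
    unfolding r(3) \<tau>_def by blast+
qed

lemma cos_mult_norm_le:
  fixes u :: modes and B :: "int \<Rightarrow> real"
  assumes "\<And>l. \<bar>k - l\<bar> = 1 \<Longrightarrow> C * cmod (u l) \<le> B l" "0 \<le> C"
  shows "C * cmod (cos_mult u k) \<le> (B (k - 1) + B (k + 1)) / 2"
proof -
  have "cmod (cos_mult u k) \<le> (cmod (u (k - 1)) + cmod (u (k + 1))) / 2"
    by (simp add: cos_mult_def norm_divide norm_triangle_ineq)
  then have "C * cmod (cos_mult u k) \<le> C * ((cmod (u (k - 1)) + cmod (u (k + 1))) / 2)"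
    using assms(2) by (rule mult_left_mono)
  also have "\<dots> \<le> (B (k - 1) + B (k + 1)) / 2"
    using assms(1)[of "k - 1"] assms(1)[of "k + 1"] by (simp add: algebra_simps)
  finally show ?thesis .
qed

text \<open>Multiplication by cos passes half of each neighbour to mode \<open>k\<close>, and
  \<open>coupling_bounds\<close> exchanges the weight of \<open>k\<close> for that of the neighbour.
  All four forcing terms then share the rate \<Phi> / sqrt t.\<close>

lemma forcing_bound:
  fixes f g :: "real \<Rightarrow> real" and z q :: modes
  assumes "0 < \<xi>" "2 * \<xi> \<le> t" and "0 \<le> \<Phi>"
    and f: "\<bar>f t\<bar> \<le> \<Phi> * (1 + t\<^sup>2) powr (1/4)"
    and g: "\<bar>g t\<bar> \<le> \<Phi> / (1 + t\<^sup>2) powr (1/4)"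
  defines "y \<equiv> \<lambda>l. mode_weight \<xi> t l * (cmod (z l) + cmod (q l))"
  shows "mode_weight \<xi> t k * (cmod (rhs_Z \<xi> f t z k) + cmod (rhs_Q \<xi> f g t z q k))
    \<le> 24 * \<Phi> / sqrt t * (y (k - 1) + y (k + 1))"
proof -
  define P where "P = (\<lambda>l. lap_symbol \<xi> t l powr (1/4))"
  define x where "x = (1 + t\<^sup>2) powr (1/4)"
  define w where "w = mode_weight \<xi> t k"
  define A B where "A = (\<lambda>l. mode_weight \<xi> t l * (16 / sqrt t) * cmod (z l))"
    and "B = (\<lambda>l. mode_weight \<xi> t l * (16 / sqrt t) * cmod (q l))"
  have P: "P l > 0" for l
    using lap_symbol_pos[OF assms(1), of t l] by (simp add: P_def)
  have pw: "lap_symbol \<xi> t l powr (-1/4) = 1 / P l" "lap_symbol \<xi> t l powr (1/4) = P l"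
    "lap_symbol \<xi> t l powr (-3/4) = 1 / P l ^ 3" for l
    using lap_symbol_pos[OF assms(1), of t l]
    by (simp_all add: P_def powr_minus_divide powr_powr flip: powr_numeral)
  have x: "x > 0" using one_plus_sq_pos[of t] by (simp add: x_def)
  have x4: "1 + t\<^sup>2 = x ^ 4"
    using one_plus_sq_pos[of t] by (simp add: x_def powr_powr flip: powr_numeral)
  have w: "w \<ge> 0" using assms by (simp add: w_def mode_weight_def)
  have x4_abs: "\<bar>1 / x ^ 4\<bar> = 1 / x ^ 4" using x by simp
  have x4': "\<Phi> / x ^ 3 = \<Phi> * x / x ^ 4"
    using x by (simp add: power4_eq_xxxx power3_eq_cube)
  have f': "\<bar>f t\<bar> \<le> \<Phi> * x" "\<bar>f t\<bar> / x ^ 4 \<le> \<Phi> / x ^ 3"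
    using f x divide_right_mono[OF f, of "x ^ 4"] by (simp_all add: x_def[symmetric] x4')
  have g': "\<bar>g t\<bar> \<le> \<Phi> / x" using g by (simp add: x_def)
  have coup: "w * (\<xi> * (x / (P k * P l ^ 3))) \<le> mode_weight \<xi> t l * (16 / sqrt t)"
    "w * (\<xi> * (P l / (x ^ 3 * P k))) \<le> mode_weight \<xi> t l * (16 / sqrt t)"
    "w * (\<xi> * (P k / (x * P l ^ 3))) \<le> mode_weight \<xi> t l * (16 / sqrt t)"
    "w * (\<xi> * (P k / (x ^ 3 * P l))) \<le> mode_weight \<xi> t l * (16 / sqrt t)" if "\<bar>k - l\<bar> = 1" for l
    unfolding P_def x_def w_def by (rule coupling_bounds[OF assms(1,2) that])+
  have norm_dy: "cmod (dy \<xi> (lap_pow \<xi> t s u) l) = \<xi> * lap_symbol \<xi> t l powr s * cmod (u l)" for s u l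
    using assms(1) by (simp add: dy_def lap_pow_def multiplier_def norm_mult)
  have norm_lap: "cmod (lap_pow \<xi> t s u l) = lap_symbol \<xi> t l powr s * cmod (u l)" for s u l
    by (simp add: lap_pow_def multiplier_def norm_mult)
  have Z1: "w * (x * (1 / P k)) * cmod (cos_mult (dy \<xi> (lap_pow \<xi> t (-3/4) z)) k) \<le> (A (k - 1) + A (k + 1)) / 2"
  proof (rule cos_mult_norm_le)
    fix l assume "\<bar>k - l\<bar> = 1"
    from mult_right_mono[OF coup(1)[OF this] norm_ge_zero[of "z l"]]
    show "w * (x * (1 / P k)) * cmod (dy \<xi> (lap_pow \<xi> t (-3/4) z) l) \<le> A l"
      unfolding norm_dy pw A_def by (simp add: mult_ac)
  qed (use w x P[of k] in simp)
  have Z2: "w * (1 / x ^ 3 * (1 / P k)) * cmod (cos_mult (dy \<xi> (lap_pow \<xi> t (1/4) z)) k) \<le> (A (k - 1) + A (k + 1)) / 2"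
  proof (rule cos_mult_norm_le)
    fix l assume "\<bar>k - l\<bar> = 1"
    from mult_right_mono[OF coup(2)[OF this] norm_ge_zero[of "z l"]]
    show "w * (1 / x ^ 3 * (1 / P k)) * cmod (dy \<xi> (lap_pow \<xi> t (1/4) z) l) \<le> A l"
      unfolding norm_dy pw A_def by (simp add: mult_ac)
  qed (use w x P[of k] in simp)
  have Q1: "w * (1 / x * P k) * cmod (cos_mult (dy \<xi> (lap_pow \<xi> t (-3/4) z)) k) \<le> (A (k - 1) + A (k + 1)) / 2"
  proof (rule cos_mult_norm_le)
    fix l assume "\<bar>k - l\<bar> = 1"
    from mult_right_mono[OF coup(3)[OF this] norm_ge_zero[of "z l"]]
    show "w * (1 / x * P k) * cmod (dy \<xi> (lap_pow \<xi> t (-3/4) z) l) \<le> A l"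
      unfolding norm_dy pw A_def by (simp add: mult_ac)
  qed (use w x P[of k] in simp)
  have Q2: "w * (1 / x ^ 3 * P k) * cmod (cos_mult (dy \<xi> (lap_pow \<xi> t (-1/4) q)) k) \<le> (B (k - 1) + B (k + 1)) / 2"
  proof (rule cos_mult_norm_le)
    fix l assume "\<bar>k - l\<bar> = 1"
    from mult_right_mono[OF coup(4)[OF this] norm_ge_zero[of "q l"]]
    show "w * (1 / x ^ 3 * P k) * cmod (dy \<xi> (lap_pow \<xi> t (-1/4) q) l) \<le> B l"
      unfolding norm_dy pw B_def by (simp add: mult_ac)
  qed (use w x P[of k] in simp)
  define cz where "cz = cmod (cos_mult (dy \<xi> (lap_pow \<xi> t (-3/4) z)) k)"
  define cz' where "cz' = cmod (cos_mult (dy \<xi> (lap_pow \<xi> t (1/4) z)) k)"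
  define cq where "cq = cmod (cos_mult (dy \<xi> (lap_pow \<xi> t (-1/4) q)) k)"
  have "cmod (rhs_Z \<xi> f t z k) \<le> \<bar>f t\<bar> * (1 / P k * cz) + \<bar>f t\<bar> / x ^ 4 * (1 / P k * cz')"
    unfolding rhs_Z_def x4 cz_def cz'_def
    by (rule order.trans[OF norm_triangle_ineq]) (simp only: norm_mult norm_of_real norm_lap pw x4_abs, simp)
  also have "\<dots> \<le> \<Phi> * x * (1 / P k * cz) + \<Phi> / x ^ 3 * (1 / P k * cz')"
    using P[of k] by (intro add_mono mult_right_mono f') (auto simp: cz_def cz'_def)
  finally have "w * cmod (rhs_Z \<xi> f t z k) \<le> w * (\<Phi> * x * (1 / P k * cz) + \<Phi> / x ^ 3 * (1 / P k * cz'))"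
    using w by (rule mult_left_mono)
  also have "\<dots> = \<Phi> * (w * (x * (1 / P k)) * cz + w * (1 / x ^ 3 * (1 / P k)) * cz')"
    by (simp add: algebra_simps)
  also have "\<dots> \<le> \<Phi> * (A (k - 1) + A (k + 1))"
    by (rule mult_left_mono[OF order.trans[OF add_mono[OF Z1[folded cz_def] Z2[folded cz'_def]]] assms(3)]) simp
  finally have 1: "w * cmod (rhs_Z \<xi> f t z k) \<le> \<Phi> * (A (k - 1) + A (k + 1))" .
  have "cmod (rhs_Q \<xi> f g t z q k) \<le> \<bar>g t\<bar> * (P k * cz) + \<bar>f t\<bar> / x ^ 4 * (P k * cq)"
    unfolding rhs_Q_def x4 cz_def cq_def
    by (rule order.trans[OF norm_triangle_ineq]) (simp only: norm_mult norm_of_real norm_lap pw x4_abs, simp)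
  also have "\<dots> \<le> \<Phi> / x * (P k * cz) + \<Phi> / x ^ 3 * (P k * cq)"
    using P[of k] by (intro add_mono mult_right_mono f' g') (auto simp: cz_def cq_def)
  finally have "w * cmod (rhs_Q \<xi> f g t z q k) \<le> w * (\<Phi> / x * (P k * cz) + \<Phi> / x ^ 3 * (P k * cq))"
    using w by (rule mult_left_mono)
  also have "\<dots> = \<Phi> * (w * (1 / x * P k) * cz + w * (1 / x ^ 3 * P k) * cq)"
    by (simp add: algebra_simps)
  also have "\<dots> \<le> \<Phi> * ((A (k - 1) + A (k + 1)) / 2 + (B (k - 1) + B (k + 1)) / 2)"
    by (rule mult_left_mono[OF add_mono[OF Q1[folded cz_def] Q2[folded cq_def]] assms(3)])
  finally have 2: "w * cmod (rhs_Q \<xi> f g t z q k)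
      \<le> \<Phi> * ((A (k - 1) + A (k + 1)) / 2 + (B (k - 1) + B (k + 1)) / 2)" .
  have "0 \<le> mode_weight \<xi> t l" "0 \<le> 16 / sqrt t" for l
    using assms(1,2) by (auto simp: mode_weight_def)
  then have AB: "0 \<le> A l" "0 \<le> B l" for l
    by (simp_all add: A_def B_def)
  have AB_add: "A l + B l = 16 / sqrt t * y l" for l
    by (simp add: A_def B_def y_def algebra_simps)
  \<comment> \<open>The \<open>Z\<close> modes enter three of the four terms and the
    \<open>Q\<close> modes one, each with factor 1/2. Bounding both by 3/2 yields the constant 24 =
    3/2 * 16.\<close>
  have arith: "X + (X / 2 + (b1 + b2) / 2) \<le> 3 / 2 * (X + (b1 + b2))" if "0 \<le> b1" "0 \<le> b2" for X b1 b2 :: real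
    using that by simp
  have "w * (cmod (rhs_Z \<xi> f t z k) + cmod (rhs_Q \<xi> f g t z q k))
      \<le> \<Phi> * ((A (k - 1) + A (k + 1)) + ((A (k - 1) + A (k + 1)) / 2 + (B (k - 1) + B (k + 1)) / 2))"
    unfolding distrib_left[of w] distrib_left[of \<Phi> "A (k - 1) + A (k + 1)"]
    by (rule add_mono[OF 1 2])
  also have "\<dots> \<le> \<Phi> * (3 / 2 * ((A (k - 1) + A (k + 1)) + (B (k - 1) + B (k + 1))))"
    by (rule mult_left_mono[OF arith[OF AB(2) AB(2)] assms(3)])
  also have "\<dots> = \<Phi> * (3 / 2 * ((A (k - 1) + B (k - 1)) + (A (k + 1) + B (k + 1))))"
    by (simp only: add_ac)
  also have "\<dots> = 24 * \<Phi> / sqrt t * (y (k - 1) + y (k + 1))"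
    unfolding AB_add by (simp add: algebra_simps add_divide_distrib)
  finally show ?thesis by (simp add: w_def)
qed

section \<open>Square summable sequences and local boundedness of solutions\<close>

lemma finite_energy_diff:
  assumes "finite_energy Z Q" "finite_energy Z' Q'"
  shows "finite_energy (\<lambda>k. Z k - Z' k) (\<lambda>k. Q k - Q' k)"
  unfolding finite_energy_def
proof (rule summable_on_comparison_test)
  show "(\<lambda>k. 2 * ((cmod (Z k))\<^sup>2 + (cmod (Q k))\<^sup>2) + 2 * ((cmod (Z' k))\<^sup>2 + (cmod (Q' k))\<^sup>2)) summable_on UNIV"
    by (intro summable_on_add[OF summable_on_cmult_right summable_on_cmult_right]
        assms[unfolded finite_energy_def])
  have "(cmod (a - b))\<^sup>2 \<le> 2 * (cmod a)\<^sup>2 + 2 * (cmod b)\<^sup>2" for a b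
  proof -
    have "(cmod (a - b))\<^sup>2 \<le> (cmod a + cmod b)\<^sup>2"
      by (intro power_mono norm_triangle_ineq4) auto
    also have "\<dots> \<le> 2 * (cmod a)\<^sup>2 + 2 * (cmod b)\<^sup>2"
      using sum_squares_bound[of "cmod a" "cmod b"] by (simp add: power2_sum)
    finally show ?thesis .
  qed
  from add_mono[OF this this]
  show "(cmod (Z k - Z' k))\<^sup>2 + (cmod (Q k - Q' k))\<^sup>2
      \<le> 2 * ((cmod (Z k))\<^sup>2 + (cmod (Q k))\<^sup>2) + 2 * ((cmod (Z' k))\<^sup>2 + (cmod (Q' k))\<^sup>2)" for k
    by (simp add: algebra_simps)
qed simp

lemma sum_le_energy_norm:
  assumes "finite_energy Z Q" "finite A"
  shows "(\<Sum>k\<in>A. (cmod (Z k))\<^sup>2 + (cmod (Q k))\<^sup>2) \<le> (energy_norm Z Q)\<^sup>2"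
proof -
  have "(energy_norm Z Q)\<^sup>2 = (\<Sum>\<^sub>\<infinity>k. (cmod (Z k))\<^sup>2 + (cmod (Q k))\<^sup>2)"
    unfolding energy_norm_def by (intro real_sqrt_pow2 infsum_nonneg) simp
  then show ?thesis
    using finite_sum_le_infsum[OF assms(1)[unfolded finite_energy_def] assms(2)] by simp
qed

lemma energy_norm_leI:
  assumes "finite_energy Z Q" "0 \<le> B"
    and "\<And>A. finite A \<Longrightarrow> (\<Sum>k\<in>A. (cmod (Z k))\<^sup>2 + (cmod (Q k))\<^sup>2) \<le> B\<^sup>2"
  shows "energy_norm Z Q \<le> B"
  unfolding energy_norm_def
  using assms by (intro real_le_lsqrt infsum_le_finite_sums infsum_nonneg)
    (auto simp: finite_energy_def)

lemma energy_norm_proj_le: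
  assumes "finite_energy Z Q"
  shows "energy_norm (proj K Z) (proj K Q) \<le> energy_norm Z Q"
  unfolding energy_norm_def
proof (intro real_sqrt_le_mono infsum_mono)
  show *: "(cmod (proj K Z k))\<^sup>2 + (cmod (proj K Q k))\<^sup>2 \<le> (cmod (Z k))\<^sup>2 + (cmod (Q k))\<^sup>2" for k
    by (simp add: proj_def)
  show "(\<lambda>k. (cmod (proj K Z k))\<^sup>2 + (cmod (proj K Q k))\<^sup>2) summable_on UNIV"
    by (rule summable_on_comparison_test[OF assms[unfolded finite_energy_def] *]) simp
  show "(\<lambda>k. (cmod (Z k))\<^sup>2 + (cmod (Q k))\<^sup>2) summable_on UNIV"
    using assms by (simp add: finite_energy_def)
qed

text \<open>Supplies the a priori bound \<open>M\<close> of \<open>chain_gronwall\<close>.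
  Continuity in the energy norm bounds all finite partial sums near each time, and the bisection
  principle \<open>Bolzano\<close> patches these local bounds over the compact interval.\<close>

lemma solution_bounded_on_interval:
  assumes sol: "linearized_boussinesq_solution \<alpha> \<xi> f g T Z Q" and "{a..b} \<subseteq> T" "a \<le> b"
  obtains M where "\<And>A t. finite A \<Longrightarrow> t \<in> {a..b} \<Longrightarrow>
    (\<Sum>k\<in>A. (cmod (Z t k))\<^sup>2 + (cmod (Q t k))\<^sup>2) \<le> M"
proof -
  define S where "S = (\<lambda>A t. \<Sum>k\<in>A. (cmod (Z t k))\<^sup>2 + (cmod (Q t k))\<^sup>2)"
  define I where "I = {a..b}"
  have IT: "I \<subseteq> T" using assms(2) by (simp add: I_def)
  \<comment> \<open>The small intervals tested by \<open>Bolzano\<close> may stick out of [a, b],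
    where nothing is known about the solution; hence the intersection with \<open>I\<close>.\<close>
  let ?P = "\<lambda>u v. \<exists>M. \<forall>t\<in>{u..v} \<inter> I. \<forall>A. finite A \<longrightarrow> S A t \<le> M"
  have in_I: "x \<in> I" if "a \<le> x" "x \<le> b" for x using that by (simp add: I_def)
  have "\<exists>M. \<forall>t\<in>{a..b} \<inter> I. \<forall>A. finite A \<longrightarrow> S A t \<le> M"
  proof (rule Bolzano[where P = ?P])
    show "a \<le> b" by fact
  next
    fix u v w :: real
    assume "?P u v" "?P v w"
    then obtain M1 M2 where "\<forall>t\<in>{u..v} \<inter> I. \<forall>A. finite A \<longrightarrow> S A t \<le> M1"
      "\<forall>t\<in>{v..w} \<inter> I. \<forall>A. finite A \<longrightarrow> S A t \<le> M2" by blast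
    then have "S A t \<le> max M1 M2" if "t \<in> {u..w} \<inter> I" "finite A" for A t
      using that by (cases "t \<le> v") (auto simp: le_max_iff_disj)
    then show "?P u w" by blast
  next
    fix x assume "a \<le> x" "x \<le> b"
    then have x: "x \<in> T" using IT in_I by blast
    let ?D = "\<lambda>s. energy_norm (\<lambda>k. Z s k - Z x k) (\<lambda>k. Q s k - Q x k)"
    have fin: "finite_energy (Z s) (Q s)" if "s \<in> T" for s
      using sol that by (auto simp: linearized_boussinesq_solution_def)
    have "(?D \<longlongrightarrow> 0) (at x within T)"
      using sol x by (auto simp: linearized_boussinesq_solution_def)
    then have "\<forall>\<^sub>F s in at x within T. ?D s < 1"
      by (rule order_tendstoD) simp
    then obtain d where d: "d > 0" "\<And>s. s \<in> T \<Longrightarrow> s \<noteq> x \<Longrightarrow> dist s x < d \<Longrightarrow> ?D s < 1"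
      unfolding eventually_at by blast
    have bound: "S A s \<le> 2 * (energy_norm (Z x) (Q x))\<^sup>2 + 2"
      if s: "s \<in> T" "dist s x < d" and A: "finite A" for A s
    proof -
      have D: "?D s \<le> 1"
        using d(2)[OF s(1) _ s(2)] by (cases "s = x") (auto simp: energy_norm_def)
      have D0: "0 \<le> ?D s" by (simp add: energy_norm_def infsum_nonneg)
      have sq: "(cmod w)\<^sup>2 \<le> 2 * (cmod u)\<^sup>2 + 2 * (cmod (w - u))\<^sup>2" for w u
      proof -
        have "(cmod w)\<^sup>2 \<le> (cmod u + cmod (w - u))\<^sup>2"
          by (intro power_mono norm_triangle_sub) auto
        also have "\<dots> \<le> 2 * (cmod u)\<^sup>2 + 2 * (cmod (w - u))\<^sup>2"
          using sum_squares_bound[of "cmod u" "cmod (w - u)"] by (simp add: power2_sum)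
        finally show ?thesis .
      qed
      have "S A s \<le> (\<Sum>k\<in>A. 2 * ((cmod (Z x k))\<^sup>2 + (cmod (Q x k))\<^sup>2)
          + 2 * ((cmod (Z s k - Z x k))\<^sup>2 + (cmod (Q s k - Q x k))\<^sup>2))"
        unfolding S_def
      proof (rule sum_mono)
        show "(cmod (Z s k))\<^sup>2 + (cmod (Q s k))\<^sup>2 \<le> 2 * ((cmod (Z x k))\<^sup>2 + (cmod (Q x k))\<^sup>2)
          + 2 * ((cmod (Z s k - Z x k))\<^sup>2 + (cmod (Q s k - Q x k))\<^sup>2)" for k
          using sq[of "Z s k" "Z x k"] sq[of "Q s k" "Q x k"] by simp
      qed
      also have "\<dots> = 2 * S A x + 2 * (\<Sum>k\<in>A. (cmod (Z s k - Z x k))\<^sup>2 + (cmod (Q s k - Q x k))\<^sup>2)"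
        unfolding S_def by (simp add: sum.distrib flip: sum_distrib_left)
      also have "\<dots> \<le> 2 * (energy_norm (Z x) (Q x))\<^sup>2 + 2 * (?D s)\<^sup>2"
        unfolding S_def
        by (intro add_mono mult_left_mono sum_le_energy_norm A fin[OF x] finite_energy_diff fin[OF s(1)]) auto
      also have "\<dots> \<le> 2 * (energy_norm (Z x) (Q x))\<^sup>2 + 2"
        using power_mono[OF D D0, of 2] by simp
      finally show ?thesis .
    qed
    show "\<exists>d>0. \<forall>u v. u \<le> x \<and> x \<le> v \<and> v - u < d \<longrightarrow> ?P u v"
    proof (rule exI[of _ d], rule conjI[OF d(1)], intro allI impI)
      fix u v assume uv: "u \<le> x \<and> x \<le> v \<and> v - u < d"
      have "dist t x < d" if "t \<in> {u..v}" for t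
        using that uv by (auto simp: dist_real_def)
      then show "\<exists>M. \<forall>t\<in>{u..v} \<inter> I. \<forall>A. finite A \<longrightarrow> S A t \<le> M"
        using bound IT by (intro exI[of _ "2 * (energy_norm (Z x) (Q x))\<^sup>2 + 2"]) blast
    qed
  qed
  then obtain M where "\<forall>t\<in>{a..b} \<inter> I. \<forall>A. finite A \<longrightarrow> S A t \<le> M" by blast
  then show thesis by (intro that[of M]) (auto simp: S_def I_def)
qed

section \<open>The weighted energy of a single mode and its growth rate\<close>

definition mode_angle :: "real \<Rightarrow> real \<Rightarrow> int \<Rightarrow> real \<Rightarrow> real" where
  "mode_angle \<alpha> \<xi> k t = 1 / sqrt \<alpha> * (real_of_int k * t - \<xi>)
     / sqrt ((real_of_int k)\<^sup>2 + (\<xi> - real_of_int k * t)\<^sup>2)"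

text \<open>The real inner product of two complex numbers is the real part of one times the
  conjugate of the other, so this is the energy with cross term times the squared weight.\<close>

definition mode_energy ::
    "real \<Rightarrow> real \<Rightarrow> (real \<Rightarrow> modes) \<Rightarrow> (real \<Rightarrow> modes) \<Rightarrow> int \<Rightarrow> real \<Rightarrow> real" where
  "mode_energy \<alpha> \<xi> Z Q k t = (mode_weight \<xi> t k)\<^sup>2 *
     ((cmod (Z t k))\<^sup>2 + (cmod (Q t k))\<^sup>2 + mode_angle \<alpha> \<xi> k t * (Z t k \<bullet> Q t k))"

lemma mode_angle_le:
  assumes "0 < \<alpha>"
  shows "\<bar>mode_angle \<alpha> \<xi> k t\<bar> \<le> 1 / sqrt \<alpha>"
  unfolding mode_angle_def by (rule energy_angle_bound) (use assms in simp)

lemma mode_energy_bounds: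
  assumes "0 < \<alpha>"
  shows "(1 - 1 / sqrt \<alpha> / 2) * ((mode_weight \<xi> t k)\<^sup>2 * ((cmod (Z t k))\<^sup>2 + (cmod (Q t k))\<^sup>2))
      \<le> mode_energy \<alpha> \<xi> Z Q k t"
    and "mode_energy \<alpha> \<xi> Z Q k t
      \<le> (1 + 1 / sqrt \<alpha> / 2) * ((mode_weight \<xi> t k)\<^sup>2 * ((cmod (Z t k))\<^sup>2 + (cmod (Q t k))\<^sup>2))"
  unfolding mode_energy_def
  by (subst mult.left_commute, intro mult_left_mono energy_bounds mode_angle_le assms zero_le_power2)+

text \<open>With \<lambda> the symbol of the mode, n^2 (1 + t^2) \<le> 4 \<lambda> and |n| \<le> 2
  sqrt \<lambda> bound |n|^3 / \<lambda>^(3/2) by 8 / (1 + t^2), and 1 / sqrt \<alpha> < 2 doubles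
  this. The bound is uniform in \<open>k\<close>; for k = 0 the angle is constant.\<close>

lemma mode_angle_deriv:
  assumes "1/4 < \<alpha>" "0 < \<xi>" "2 * \<xi> \<le> t"
  obtains c' where "\<bar>c'\<bar> \<le> 16 / (1 + t\<^sup>2)"
    and "\<And>S. (mode_angle \<alpha> \<xi> k has_real_derivative c') (at t within S)"
proof -
  define n where "n = real_of_int k"
  define L where "L = lap_symbol \<xi> t k"
  have L: "L > 0" "L = n\<^sup>2 + (\<xi> - n * t)\<^sup>2"
    using lap_symbol_pos[OF assms(2)] by (simp_all add: L_def lap_symbol_def n_def)
  define c' where "c' = 1 / sqrt \<alpha> * n ^ 3 / (L * sqrt L)"
  have J: "1 + t\<^sup>2 \<ge> 1" by simp
  have "\<bar>n\<bar> ^ 3 * (1 + t\<^sup>2) \<le> 8 * (L * sqrt L)"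
  proof (cases "k = 0")
    case False
    have *: "n\<^sup>2 * (1 + t\<^sup>2) \<le> 4 * L"
      unfolding n_def L_def by (rule lap_symbol_bounds[OF assms(2,3) False])
    have "n\<^sup>2 * 1 \<le> n\<^sup>2 * (1 + t\<^sup>2)" by (intro mult_left_mono J) simp
    also note *
    finally have "\<bar>n\<bar> \<le> sqrt (4 * L)" by (intro real_le_rsqrt) simp
    then have "\<bar>n\<bar> \<le> 2 * sqrt L" by (simp add: real_sqrt_mult)
    from mult_mono[OF * this] have "n\<^sup>2 * (1 + t\<^sup>2) * \<bar>n\<bar> \<le> 4 * L * (2 * sqrt L)"
      using L(1) by simp
    moreover have "\<bar>n\<bar> ^ 3 = n\<^sup>2 * \<bar>n\<bar>"
      by (simp add: power3_eq_cube power2_eq_square abs_mult_self_eq)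
    ultimately show ?thesis by (simp add: mult_ac)
  qed (use L in \<open>simp add: n_def\<close>)
  then have "\<bar>n\<bar> ^ 3 / (L * sqrt L) \<le> 8 / (1 + t\<^sup>2)"
    using L(1) one_plus_sq_pos[of t] by (simp add: divide_simps mult_ac)
  moreover have "1 / sqrt \<alpha> \<le> 2" using inverse_sqrt_less_two[OF assms(1)] by simp
  ultimately have "1 / sqrt \<alpha> * (\<bar>n\<bar> ^ 3 / (L * sqrt L)) \<le> 2 * (8 / (1 + t\<^sup>2))"
    using L(1) assms(1) by (intro mult_mono) auto
  then have "\<bar>c'\<bar> \<le> 16 / (1 + t\<^sup>2)"
    using L(1) assms(1) by (simp add: c'_def abs_mult power_abs)
  moreover have "(mode_angle \<alpha> \<xi> k has_real_derivative c') (at t within S)" for S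
    unfolding mode_angle_def c'_def L(2) n_def
    by (rule energy_angle_deriv) (use L in \<open>simp add: n_def\<close>)
  ultimately show thesis by (rule that)
qed

lemma mode_weight_sq_deriv:
  assumes "0 < \<xi>" "0 < t"
  obtains w' where "w' \<le> 0"
    and "\<And>S. S \<subseteq> {0<..} \<Longrightarrow> ((\<lambda>t. (mode_weight \<xi> t k)\<^sup>2) has_real_derivative w') (at t within S)"
proof
  show "(if k = 0 then 0 else - \<xi> / t\<^sup>2) \<le> 0" using assms by simp
  fix S :: "real set" assume "S \<subseteq> {0<..}"
  have "((\<lambda>t. if k = 0 then 1 else \<xi> / t) has_real_derivative (if k = 0 then 0 else - \<xi> / t\<^sup>2)) (at t)"
    using assms by (auto intro!: derivative_eq_intros simp: power2_eq_square)
  moreover have "\<forall>\<^sub>F s in nhds t. s \<in> {0<..}"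
    using assms by (intro eventually_nhds_in_open) auto
  then have "\<forall>\<^sub>F s in nhds t. (mode_weight \<xi> s k)\<^sup>2 = (if k = 0 then 1 else \<xi> / s)"
    by (rule eventually_mono) (use assms in \<open>auto simp: mode_weight_def power_divide\<close>)
  ultimately have "((\<lambda>t. (mode_weight \<xi> t k)\<^sup>2) has_real_derivative (if k = 0 then 0 else - \<xi> / t\<^sup>2)) (at t)"
    by (subst DERIV_cong_ev[OF refl _ refl])
  then show "((\<lambda>t. (mode_weight \<xi> t k)\<^sup>2) has_real_derivative (if k = 0 then 0 else - \<xi> / t\<^sup>2)) (at t within S)"
    by (rule has_field_derivative_at_within)
qed

text \<open>Brings the equation into the form of \<open>energy_deriv\<close>: \<open>m\<close> is
  sqrt \<alpha> times the symbol of \<open>M_op\<close>, and \<open>cm\<close> shows that the angle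
  times \<open>m\<close> is minus the symbol of \<open>L_op\<close>. This identity dictates the
  choice of \<open>mode_angle\<close>.\<close>

lemma solution_mode_energy_deriv:
  assumes sol: "linearized_boussinesq_solution \<alpha> \<xi> f g T Z Q" and "t \<in> T"
    and "1/4 < \<alpha>" "0 < \<xi>"
    and c: "(mode_angle \<alpha> \<xi> k has_real_derivative c') (at t within T)"
  defines "F \<equiv> rhs_Z \<xi> f t (Z t) k" and "G \<equiv> rhs_Q \<xi> f g t (Z t) (Q t) k"
  shows "((\<lambda>s. (cmod (Z s k))\<^sup>2 + (cmod (Q s k))\<^sup>2 + mode_angle \<alpha> \<xi> k s * (Z s k \<bullet> Q s k)) has_real_derivative
    c' * (Z t k \<bullet> Q t k) + 2 * (Z t k \<bullet> F) + 2 * (Q t k \<bullet> G)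
      + mode_angle \<alpha> \<xi> k t * (F \<bullet> Q t k + Z t k \<bullet> G)) (at t within T)"
proof -
  define n where "n = real_of_int k"
  define L where "L = lap_symbol \<xi> t k"
  have L: "L > 0" "L = n\<^sup>2 + (\<xi> - n * t)\<^sup>2"
    using lap_symbol_pos[OF assms(4)] by (simp_all add: L_def lap_symbol_def n_def)
  define m where "m = sqrt \<alpha> * (n / L powr (1/2))"
  have cm: "mode_angle \<alpha> \<xi> k t * m = - (n * (\<xi> - n * t) / L)"
  proof -
    have "sqrt L * sqrt L = L" "sqrt L > 0" "sqrt \<alpha> > 0" using L(1) assms(3) by auto
    then show ?thesis
      unfolding mode_angle_def m_def n_def[symmetric] L(2)[symmetric] powr_half_sqrt[OF less_imp_le[OF L(1)]]
      by (simp add: divide_simps) (simp add: algebra_simps)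
  qed
  have Lop: "L_op \<xi> t u k = - (mode_angle \<alpha> \<xi> k t * m) *\<^sub>R u k" for u
    unfolding cm by (simp add: L_op_def multiplier_def n_def L_def scaleR_conv_of_real)
  have Mop: "complex_of_real (sqrt \<alpha>) * M_op \<xi> t u k = m *\<^sub>R u k" for u
    by (simp add: M_op_def multiplier_def m_def n_def L_def scaleR_conv_of_real)
  have AZ: "F - A_Z \<alpha> \<xi> t (Z t) (Q t) k
      = - (mode_angle \<alpha> \<xi> k t * m / 2) *\<^sub>R Z t k - m *\<^sub>R Q t k + F"
    unfolding A_Z_def Lop Mop by (simp add: scaleR_conv_of_real)
  have AQ: "G - A_Q \<alpha> \<xi> t (Z t) (Q t) k
      = m *\<^sub>R Z t k + (mode_angle \<alpha> \<xi> k t * m / 2) *\<^sub>R Q t k + G"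
    unfolding A_Q_def mult_minus_left Lop Mop by (simp add: scaleR_conv_of_real)
  have "((\<lambda>s. Z s k) has_vector_derivative F - A_Z \<alpha> \<xi> t (Z t) (Q t) k) (at t within T)"
    "((\<lambda>s. Q s k) has_vector_derivative G - A_Q \<alpha> \<xi> t (Z t) (Q t) k) (at t within T)"
    using sol \<open>t \<in> T\<close> unfolding linearized_boussinesq_solution_def F_def G_def by blast+
  from energy_deriv[OF this[unfolded AZ AQ] c] show ?thesis .
qed

text \<open>The local inequality for \<open>chain_gronwall\<close>. The integrable part of the rate
  comes from the angle, with 8 half of the 16 in \<open>mode_angle_deriv\<close>; the part with 1 /
  sqrt t comes from the forcing, with 96 = 2 * 24 * 2.\<close>

lemma mode_energy_deriv_le:
  assumes sol: "linearized_boussinesq_solution \<alpha> \<xi> f g T Z Q" and "t \<in> T" and T: "T \<subseteq> {2 * \<xi>..}"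
    and \<alpha>: "1/4 < \<alpha>" and \<xi>: "0 < \<xi>" and "0 \<le> \<Phi>"
    and f: "\<bar>f t\<bar> \<le> \<Phi> * (1 + t\<^sup>2) powr (1/4)"
    and g: "\<bar>g t\<bar> \<le> \<Phi> / (1 + t\<^sup>2) powr (1/4)"
  defines "\<kappa> \<equiv> 1 - 1 / sqrt \<alpha> / 2" and "e \<equiv> mode_energy \<alpha> \<xi> Z Q"
  obtains e' where "(e k has_real_derivative e') (at t within T)"
    and "e' \<le> (8 / \<kappa> * inverse (1 + t\<^sup>2) + 96 * \<Phi> / \<kappa> / sqrt t) * (e (k - 1) t + e k t + e (k + 1) t)"
proof -
  have t: "2 * \<xi> \<le> t" "0 < t" using \<open>t \<in> T\<close> T \<xi> by auto
  have T0: "T \<subseteq> {0<..}" using T \<xi> by auto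
  have \<kappa>: "\<kappa> > 0" using inverse_sqrt_less_two[OF \<alpha>] by (simp add: \<kappa>_def)
  have \<alpha>0: "\<alpha> > 0" using \<alpha> by simp
  have angle: "\<bar>mode_angle \<alpha> \<xi> k t\<bar> \<le> 2"
    using mode_angle_le[OF \<alpha>0, of \<xi> k t] inverse_sqrt_less_two[OF \<alpha>] by linarith
  define F G where "F = rhs_Z \<xi> f t (Z t) k" and "G = rhs_Q \<xi> f g t (Z t) (Q t) k"
  define N where "N = (\<lambda>l. (cmod (Z t l))\<^sup>2 + (cmod (Q t l))\<^sup>2)"
  define h where "h = mode_weight \<xi> t"
  define y where "y = (\<lambda>l. h l * (cmod (Z t l) + cmod (Q t l)))"
  define E where "E = (\<lambda>s. (cmod (Z s k))\<^sup>2 + (cmod (Q s k))\<^sup>2 + mode_angle \<alpha> \<xi> k s * (Z s k \<bullet> Q s k))"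
  have h: "h l \<ge> 0" for l using \<xi> t by (simp add: h_def mode_weight_def)
  have hN: "(h l)\<^sup>2 * N l \<le> e l t / \<kappa>" for l
  proof -
    have "\<kappa> * ((h l)\<^sup>2 * N l) \<le> e l t"
      unfolding e_def h_def N_def \<kappa>_def by (rule mode_energy_bounds(1)[OF \<alpha>0])
    then show ?thesis using \<kappa> by (simp add: pos_le_divide_eq mult.commute)
  qed
  have N0: "0 \<le> N l" for l by (simp add: N_def)
  have e0: "0 \<le> e l t" for l
  proof -
    have "0 \<le> e l t / \<kappa>" using hN[of l] N0[of l] by (meson mult_nonneg_nonneg order.trans zero_le_power2)
    then show ?thesis using \<kappa> by (simp add: zero_le_divide_iff)
  qed
  have y2: "(y l)\<^sup>2 \<le> 2 * (e l t / \<kappa>)" for l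
  proof -
    have "(cmod (Z t l) + cmod (Q t l))\<^sup>2 \<le> 2 * N l"
      using sum_squares_bound[of "cmod (Z t l)" "cmod (Q t l)"] by (simp add: N_def power2_sum)
    then have "(h l)\<^sup>2 * (cmod (Z t l) + cmod (Q t l))\<^sup>2 \<le> (h l)\<^sup>2 * (2 * N l)"
      by (rule mult_left_mono) simp
    then show ?thesis using hN[of l] by (simp add: y_def power_mult_distrib)
  qed
  \<comment> \<open>The arithmetic-geometric inequality turns a product of neighbouring amplitudes
    into a sum of their energies, as the chain inequality demands.\<close>
  have yy: "y i * y j \<le> (e i t + e j t) / \<kappa>" for i j
    using sum_squares_bound[of "y i" "y j"] y2[of i] y2[of j] by (simp add: add_divide_distrib)
  obtain c' where c': "\<bar>c'\<bar> \<le> 16 / (1 + t\<^sup>2)"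
    and c_deriv: "\<And>S. (mode_angle \<alpha> \<xi> k has_real_derivative c') (at t within S)"
    using mode_angle_deriv[OF \<alpha> \<xi> t(1)] by blast
  obtain w' where w': "w' \<le> 0"
    and w_deriv: "\<And>S. S \<subseteq> {0<..} \<Longrightarrow> ((\<lambda>t. (mode_weight \<xi> t k)\<^sup>2) has_real_derivative w') (at t within S)"
    using mode_weight_sq_deriv[OF \<xi> t(2)] by blast
  define X where "X = c' * (Z t k \<bullet> Q t k) + 2 * (Z t k \<bullet> F) + 2 * (Q t k \<bullet> G)
      + mode_angle \<alpha> \<xi> k t * (F \<bullet> Q t k + Z t k \<bullet> G)"
  have E_deriv: "(E has_real_derivative X) (at t within T)"
    unfolding E_def X_def F_def G_def
    by (rule solution_mode_energy_deriv[OF sol \<open>t \<in> T\<close> \<alpha> \<xi> c_deriv])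
  have E0: "0 \<le> E t"
  proof -
    have "0 \<le> \<kappa> * N k" using \<kappa> N0 by simp
    also have "\<dots> \<le> E t"
      using energy_bounds(1)[OF mode_angle_le[OF \<alpha>0], of "Z t k" "Q t k" \<xi> k t]
      by (simp add: \<kappa>_def N_def E_def)
    finally show ?thesis .
  qed
  have force: "h k * (cmod F + cmod G) \<le> 24 * \<Phi> / sqrt t * (y (k - 1) + y (k + 1))"
    unfolding F_def G_def h_def y_def
    by (rule forcing_bound[where f = f and g = g, OF \<xi> t(1) \<open>0 \<le> \<Phi>\<close> f g])
  have y0: "0 \<le> y k" using h by (simp add: y_def)
  show thesis
  proof
    have "e k = (\<lambda>s. (mode_weight \<xi> s k)\<^sup>2 * E s)"
      by (simp add: e_def mode_energy_def E_def fun_eq_iff)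
    then show "(e k has_real_derivative w' * E t + X * (h k)\<^sup>2) (at t within T)"
      using DERIV_mult[OF w_deriv[OF T0] E_deriv] by (simp add: h_def)
    have "X \<le> \<bar>c'\<bar> / 2 * N k + 2 * ((cmod (Z t k) + cmod (Q t k)) * (cmod F + cmod G))"
      unfolding X_def N_def by (rule energy_deriv_le[OF angle])
    also have "\<bar>c'\<bar> / 2 * N k \<le> 8 * inverse (1 + t\<^sup>2) * N k"
      using c' by (intro mult_right_mono N0) (simp add: inverse_eq_divide)
    finally have X: "X \<le> 8 * inverse (1 + t\<^sup>2) * N k
      + 2 * ((cmod (Z t k) + cmod (Q t k)) * (cmod F + cmod G))" by simp
    have "w' * E t + X * (h k)\<^sup>2 \<le> X * (h k)\<^sup>2"
      using w' E0 by (simp add: mult_nonpos_nonneg)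
    also have "\<dots> \<le> (8 * inverse (1 + t\<^sup>2) * N k
      + 2 * ((cmod (Z t k) + cmod (Q t k)) * (cmod F + cmod G))) * (h k)\<^sup>2"
      by (rule mult_right_mono[OF X]) simp
    also have "\<dots> = 8 * inverse (1 + t\<^sup>2) * ((h k)\<^sup>2 * N k) + 2 * (y k * (h k * (cmod F + cmod G)))"
      by (simp add: y_def power2_eq_square algebra_simps)
    also have "\<dots> \<le> 8 * inverse (1 + t\<^sup>2) * (e k t / \<kappa>)
        + 2 * (y k * (24 * \<Phi> / sqrt t * (y (k - 1) + y (k + 1))))"
      using y0 hN[of k] force one_plus_sq_pos[of t] by (intro add_mono mult_left_mono) auto
    also have "\<dots> = 8 / \<kappa> * inverse (1 + t\<^sup>2) * e k t
        + 48 * \<Phi> / sqrt t * (y k * y (k - 1) + y k * y (k + 1))"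
      by (simp add: algebra_simps add_divide_distrib)
    also have "\<dots> \<le> 8 / \<kappa> * inverse (1 + t\<^sup>2) * (e (k - 1) t + e k t + e (k + 1) t)
        + 48 * \<Phi> / sqrt t * (2 / \<kappa> * (e (k - 1) t + e k t + e (k + 1) t))"
    proof (intro add_mono mult_left_mono)
      have "y k * y (k - 1) + y k * y (k + 1) \<le> (e k t + e (k - 1) t) / \<kappa> + (e k t + e (k + 1) t) / \<kappa>"
        by (intro add_mono yy)
      also have "\<dots> = (2 * e k t + e (k - 1) t + e (k + 1) t) / \<kappa>"
        by (simp add: add_divide_distrib)
      also have "\<dots> \<le> (2 * (e (k - 1) t + e k t + e (k + 1) t)) / \<kappa>"
        using \<kappa> e0[of "k - 1"] e0[of "k + 1"] by (intro divide_right_mono) auto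
      finally show "y k * y (k - 1) + y k * y (k + 1) \<le> 2 / \<kappa> * (e (k - 1) t + e k t + e (k + 1) t)"
        by simp
    qed (use \<kappa> e0 \<open>0 \<le> \<Phi>\<close> t one_plus_sq_pos[of t] in \<open>auto intro!: divide_nonneg_nonneg mult_nonneg_nonneg\<close>)
    also have "\<dots> = (8 / \<kappa> * inverse (1 + t\<^sup>2) + 96 * \<Phi> / \<kappa> / sqrt t) * (e (k - 1) t + e k t + e (k + 1) t)"
      by (simp add: algebra_simps add_divide_distrib)
    finally show "w' * E t + X * (h k)\<^sup>2
        \<le> (8 / \<kappa> * inverse (1 + t\<^sup>2) + 96 * \<Phi> / \<kappa> / sqrt t) * (e (k - 1) t + e k t + e (k + 1) t)" .
  qed
qed

section \<open>Growth of the total energy and the theorem\<close>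

text \<open>The weighted energy grows by at most a constant factor. The squared weights are at most
  1 initially and at least \<xi> / b at the end, so removing them costs the single factor sqrt (b /
  \<xi>) in the norm.\<close>

lemma energy_growth:
  fixes \<alpha> F \<epsilon> \<xi> b :: real
  assumes sol: "linearized_boussinesq_solution \<alpha> \<xi> f g T Z Q"
    and T: "T \<subseteq> {2 * \<xi>..}" "{2 * \<xi>..b} \<subseteq> T" "2 * \<xi> \<le> b"
    and \<alpha>: "1/4 < \<alpha>" and \<xi>: "0 < \<xi>" and "0 \<le> F" "0 \<le> \<epsilon>" and small: "\<epsilon> * sqrt b \<le> 1"
    and f: "\<And>t. 0 \<le> t \<Longrightarrow> \<bar>f t\<bar> \<le> F * \<epsilon> * (1 + t\<^sup>2) powr (1/4)"
    and g: "\<And>t. 0 \<le> t \<Longrightarrow> \<bar>g t\<bar> \<le> F * \<epsilon> / (1 + t\<^sup>2) powr (1/4)"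
  defines "\<kappa> \<equiv> 1 - 1 / sqrt \<alpha> / 2"
  shows "energy_norm (Z b) (Q b)
    \<le> sqrt (2 / \<kappa> * exp (3 * (16 / \<kappa> + 192 * F / \<kappa>))) * sqrt (b / \<xi>)
      * energy_norm (Z (2 * \<xi>)) (Q (2 * \<xi>))"
proof -
  define a where "a = 2 * \<xi>"
  define \<Phi> where "\<Phi> = F * \<epsilon>"
  define e where "e = mode_energy \<alpha> \<xi> Z Q"
  define N where "N = (\<lambda>k t. (cmod (Z t k))\<^sup>2 + (cmod (Q t k))\<^sup>2)"
  define R where "R = (\<lambda>t. 8 / \<kappa> * arctan t + 192 * \<Phi> / \<kappa> * sqrt t)"
  define r where "r = (\<lambda>t. 8 / \<kappa> * inverse (1 + t\<^sup>2) + 96 * \<Phi> / \<kappa> / sqrt t)"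
  define n0 where "n0 = energy_norm (Z a) (Q a)"
  have \<alpha>0: "\<alpha> > 0" using \<alpha> by simp
  have \<kappa>: "0 < \<kappa>" "1 + 1 / sqrt \<alpha> / 2 \<le> 2"
    using inverse_sqrt_less_two[OF \<alpha>] by (simp_all add: \<kappa>_def)
  have \<Phi>: "0 \<le> \<Phi>" using assms by (simp add: \<Phi>_def)
  have a: "0 < a" "a \<le> b" using T \<xi> by (simp_all add: a_def)
  have inT: "t \<in> T" if "t \<in> {a..b}" for t using that T by (auto simp: a_def)
  have fin: "finite_energy (Z t) (Q t)" if "t \<in> {a..b}" for t
    using sol inT[OF that] by (auto simp: linearized_boussinesq_solution_def)
  have N0: "0 \<le> N k t" for k t by (simp add: N_def)
  have weight: "\<xi> / b \<le> (mode_weight \<xi> t k)\<^sup>2" "(mode_weight \<xi> t k)\<^sup>2 \<le> 1" if "t \<in> {a..b}" for t k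
    using that \<xi> a by (auto simp: mode_weight_def power_divide a_def divide_left_mono)
  have lower: "\<kappa> * ((mode_weight \<xi> t k)\<^sup>2 * N k t) \<le> e k t" for k t
    unfolding \<kappa>_def N_def e_def by (rule mode_energy_bounds(1)[OF \<alpha>0])
  have upper: "e k t \<le> 2 * N k t" if "t \<in> {a..b}" for k t
  proof -
    have "e k t \<le> (1 + 1 / sqrt \<alpha> / 2) * ((mode_weight \<xi> t k)\<^sup>2 * N k t)"
      unfolding N_def e_def by (rule mode_energy_bounds(2)[OF \<alpha>0])
    also have "\<dots> \<le> 2 * (1 * N k t)"
      by (intro mult_mono \<kappa>(2) weight(2)[OF that] mult_nonneg_nonneg N0 order.refl) auto
    finally show ?thesis by simp
  qed
  have e0: "0 \<le> e k t" for k t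
  proof -
    have "0 \<le> \<kappa> * ((mode_weight \<xi> t k)\<^sup>2 * N k t)"
      using \<kappa>(1) N0[of k t] by simp
    then show ?thesis using lower[of t k] by linarith
  qed
  have ex: "\<exists>e'. (e k has_real_derivative e') (at t within {a..b}) \<and>
      e' \<le> r t * (e (k - 1) t + e k t + e (k + 1) t)" if t: "t \<in> {a..b}" for k t
  proof -
    have "0 \<le> t" using t a by auto
    obtain e' where "(mode_energy \<alpha> \<xi> Z Q k has_real_derivative e') (at t within T)"
      "e' \<le> r t * (e (k - 1) t + e k t + e (k + 1) t)"
      unfolding e_def r_def \<kappa>_def \<Phi>_def
      by (rule mode_energy_deriv_le[where f = f and g = g and k = k,
            OF sol inT[OF t] T(1) \<alpha> \<xi> \<Phi>[unfolded \<Phi>_def] f[OF \<open>0 \<le> t\<close>] g[OF \<open>0 \<le> t\<close>]])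
    then show ?thesis
      using T(2) DERIV_subset unfolding e_def a_def by blast
  qed
  define e' where "e' = (\<lambda>k t. SOME d. (e k has_real_derivative d) (at t within {a..b}) \<and>
      d \<le> r t * (e (k - 1) t + e k t + e (k + 1) t))"
  have e': "(e k has_real_derivative e' k t) (at t within {a..b})"
    "e' k t \<le> r t * (e (k - 1) t + e k t + e (k + 1) t)" if "t \<in> {a..b}" for k t
    using someI_ex[OF ex[OF that, of k]] unfolding e'_def by blast+
  obtain M where M: "\<And>A t. finite A \<Longrightarrow> t \<in> {a..b} \<Longrightarrow> (\<Sum>k\<in>A. N k t) \<le> M"
    using solution_bounded_on_interval[OF sol, of a b] T(2) a(2) unfolding a_def N_def by blast
  have sum_le: "(\<Sum>k\<in>A. e k t) \<le> 2 * (\<Sum>k\<in>A. N k t)" if "t \<in> {a..b}" for A t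
    unfolding sum_distrib_left by (rule sum_mono[OF upper[OF that]])
  have chain: "(\<Sum>k\<in>A. e k b) \<le> exp (3 * (R b - R a)) * (2 * n0\<^sup>2)" if "finite A" for A
  proof (rule chain_gronwall[where e = e and e' = e' and R = R and r = r and M = "2 * M", OF a(2) e0 e'(1) _ _ e'(2) _ _ that])
    fix t assume t: "t \<in> {a..b}"
    then have "t > 0" using a by auto
    then show "(R has_real_derivative r t) (at t within {a..b})"
      unfolding R_def r_def using \<kappa>(1)
      by (auto intro!: derivative_eq_intros simp: inverse_eq_divide mult.commute)
    show "0 \<le> r t"
      unfolding r_def using \<kappa>(1) \<Phi> \<open>t > 0\<close> one_plus_sq_pos[of t] by (intro add_nonneg_nonneg) auto
    fix A :: "int set" assume "finite A"
    then show "(\<Sum>k\<in>A. e k t) \<le> 2 * M"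
      using sum_le[OF t, of A] M[OF _ t, of A] by linarith
  next
    fix A :: "int set" assume "finite A"
    have "(\<Sum>k\<in>A. N k a) \<le> n0\<^sup>2"
      unfolding N_def n0_def using a by (intro sum_le_energy_norm fin \<open>finite A\<close>) auto
    then show "(\<Sum>k\<in>A. e k a) \<le> 2 * n0\<^sup>2"
      using sum_le[of a A] a by simp
  qed
  \<comment> \<open>The arctan part contributes at most 2 * 8 / \<kappa>. In the other part
    \<epsilon> sqrt b \<le> 1 removes \<epsilon> and b, so the exponent depends only on \<alpha> and
    \<open>F\<close>.\<close>
  have "R b - R a \<le> 16 / \<kappa> + 192 * F / \<kappa>"
  proof -
    have "arctan b \<le> 2" using arctan_ubound[of b] pi_less_4 by linarith
    then have 1: "8 / \<kappa> * arctan b \<le> 8 / \<kappa> * 2"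
      using \<kappa>(1) by (intro mult_left_mono) auto
    have "192 * F / \<kappa> * (\<epsilon> * sqrt b) \<le> 192 * F / \<kappa> * 1"
      using \<kappa>(1) \<open>0 \<le> F\<close> by (intro mult_left_mono small) auto
    moreover have "0 \<le> 8 / \<kappa> * arctan a + 192 * \<Phi> / \<kappa> * sqrt a"
      using \<kappa>(1) \<Phi> a by (intro add_nonneg_nonneg mult_nonneg_nonneg) auto
    ultimately show ?thesis using 1 by (simp add: R_def \<Phi>_def mult_ac)
  qed
  then have expR: "exp (3 * (R b - R a)) \<le> exp (3 * (16 / \<kappa> + 192 * F / \<kappa>))" by simp
  have n0: "0 \<le> n0" by (simp add: n0_def energy_norm_def infsum_nonneg)
  let ?K = "2 / \<kappa> * exp (3 * (16 / \<kappa> + 192 * F / \<kappa>))"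
  have "energy_norm (Z b) (Q b) \<le> sqrt ?K * sqrt (b / \<xi>) * n0"
  proof (rule energy_norm_leI)
    show "finite_energy (Z b) (Q b)" using fin a by auto
    show "0 \<le> sqrt ?K * sqrt (b / \<xi>) * n0" using \<kappa>(1) \<xi> a n0 by auto
    fix A :: "int set" assume "finite A"
    have "\<kappa> * (\<xi> / b) * (\<Sum>k\<in>A. N k b) \<le> (\<Sum>k\<in>A. e k b)"
      unfolding sum_distrib_left
    proof (rule sum_mono)
      fix k
      have "\<kappa> * (\<xi> / b * N k b) \<le> \<kappa> * ((mode_weight \<xi> b k)\<^sup>2 * N k b)"
        using \<kappa>(1) a by (intro mult_left_mono mult_right_mono weight N0) auto
      then show "\<kappa> * (\<xi> / b) * N k b \<le> e k b" using lower[of b k] by simp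
    qed
    also have "\<dots> \<le> exp (3 * (R b - R a)) * (2 * n0\<^sup>2)" by (rule chain[OF \<open>finite A\<close>])
    also have "\<dots> \<le> exp (3 * (16 / \<kappa> + 192 * F / \<kappa>)) * (2 * n0\<^sup>2)"
      by (rule mult_right_mono[OF expR]) simp
    finally have "\<kappa> * (\<xi> / b) * (\<Sum>k\<in>A. N k b) \<le> exp (3 * (16 / \<kappa> + 192 * F / \<kappa>)) * (2 * n0\<^sup>2)" .
    moreover have pos: "0 < \<kappa> * (\<xi> / b)" using \<kappa>(1) \<xi> a by simp
    ultimately have "(\<Sum>k\<in>A. N k b) \<le> exp (3 * (16 / \<kappa> + 192 * F / \<kappa>)) * (2 * n0\<^sup>2) / (\<kappa> * (\<xi> / b))"
      by (simp only: pos_le_divide_eq[OF pos] mult.commute)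
    also have "\<dots> = ?K * (b / \<xi>) * n0\<^sup>2" by simp
    also have "\<dots> = (sqrt ?K * sqrt (b / \<xi>) * n0)\<^sup>2"
      using \<kappa>(1) \<xi> a unfolding power_mult_distrib by (subst (1 2) real_sqrt_pow2) auto
    finally show "(\<Sum>k\<in>A. (cmod (Z b k))\<^sup>2 + (cmod (Q b k))\<^sup>2) \<le> (sqrt ?K * sqrt (b / \<xi>) * n0)\<^sup>2"
      by (simp add: N_def)
  qed
  then show ?thesis by (simp only: n0_def a_def)
qed

text \<open>\<open>K\<close> is fixed before \<epsilon>, \<delta>, \<xi> and the solution. The
  length of the time interval provides the smallness required by \<open>energy_growth\<close>:
  \<epsilon>^2 t < \<delta> < 1.\<close>

lemma uniform_energy_growth:
  fixes \<alpha> :: real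
  assumes \<alpha>: "1/4 < \<alpha>"
  obtains K where "0 \<le> K"
    and "\<And>\<epsilon> \<delta> \<xi> f g Z Q t. 0 < \<epsilon> \<Longrightarrow> \<delta> < 0.1 \<Longrightarrow> 0 < \<xi> \<Longrightarrow> traveling_wave_coeffs \<alpha> \<epsilon> f g \<Longrightarrow>
      linearized_boussinesq_solution \<alpha> \<xi> f g {2 * \<xi>..<\<delta> / \<epsilon>\<^sup>2} Z Q \<Longrightarrow> t \<in> {2 * \<xi><..<\<delta> / \<epsilon>\<^sup>2} \<Longrightarrow>
      energy_norm (Z t) (Q t) \<le> K * sqrt (t / \<xi>) * energy_norm (Z (2 * \<xi>)) (Q (2 * \<xi>)) \<and>
      finite_energy (Z t) (Q t)"
proof -
  obtain F where "F > 0" and F: "\<And>\<epsilon> f g t. \<epsilon> > 0 \<Longrightarrow> traveling_wave_coeffs \<alpha> \<epsilon> f g \<Longrightarrow> t \<ge> 0 \<Longrightarrow>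
      \<bar>f t\<bar> \<le> F * \<epsilon> * (1 + t\<^sup>2) powr (1/4) \<and> \<bar>g t\<bar> \<le> F * \<epsilon> / (1 + t\<^sup>2) powr (1/4)"
    using traveling_wave_bound[OF \<alpha>] by blast
  define \<kappa> where "\<kappa> = 1 - 1 / sqrt \<alpha> / 2"
  have "0 < \<kappa>" using inverse_sqrt_less_two[OF \<alpha>] by (simp add: \<kappa>_def)
  show thesis
  proof
    show "0 \<le> sqrt (2 / \<kappa> * exp (3 * (16 / \<kappa> + 192 * F / \<kappa>)))"
      using \<open>0 < \<kappa>\<close> by simp
    fix \<epsilon> \<delta> \<xi> :: real and f g Z Q t
    assume asm: "0 < \<epsilon>" "\<delta> < 0.1" "0 < \<xi>" "traveling_wave_coeffs \<alpha> \<epsilon> f g"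
      and sol: "linearized_boussinesq_solution \<alpha> \<xi> f g {2 * \<xi>..<\<delta> / \<epsilon>\<^sup>2} Z Q"
      and t: "t \<in> {2 * \<xi><..<\<delta> / \<epsilon>\<^sup>2}"
    have "\<epsilon> * sqrt t \<le> 1"
    proof -
      have "\<epsilon>\<^sup>2 * t < \<delta>" using t asm(1) by (simp add: pos_less_divide_eq mult.commute)
      then have "sqrt (\<epsilon>\<^sup>2 * t) \<le> 1" using asm(2) by simp
      then show ?thesis using asm(1) by (simp add: real_sqrt_mult)
    qed
    then have "energy_norm (Z t) (Q t) \<le> sqrt (2 / \<kappa> * exp (3 * (16 / \<kappa> + 192 * F / \<kappa>))) * sqrt (t / \<xi>)
        * energy_norm (Z (2 * \<xi>)) (Q (2 * \<xi>))"
      unfolding \<kappa>_def using t asm(1,3) \<open>F > 0\<close> F[OF asm(1,4)]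
      by (intro energy_growth[OF sol _ _ _ \<alpha>, where \<epsilon> = \<epsilon>]) auto
    moreover have "finite_energy (Z t) (Q t)"
      using sol t by (auto simp: linearized_boussinesq_solution_def)
    ultimately show "energy_norm (Z t) (Q t) \<le> sqrt (2 / \<kappa> * exp (3 * (16 / \<kappa> + 192 * F / \<kappa>)))
        * sqrt (t / \<xi>) * energy_norm (Z (2 * \<xi>)) (Q (2 * \<xi>)) \<and> finite_energy (Z t) (Q t)" ..
  qed
qed

theorem proposition4p1:
  "\<exists>(C :: real \<Rightarrow> real) (D :: real \<Rightarrow> real \<Rightarrow> real).
    \<forall>(\<alpha>::real) (\<epsilon>::real) (\<delta>::real) (\<xi>::real) (\<gamma>::real)
      (f :: real \<Rightarrow> real) (g :: real \<Rightarrow> real) (Z :: real \<Rightarrow> modes) (Q :: real \<Rightarrow> modes).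
      \<alpha> > 1/4 \<longrightarrow>
      0 < \<epsilon> \<longrightarrow> \<epsilon> < 0.1 \<longrightarrow> 0 < \<delta> \<longrightarrow> \<delta> < 0.1 \<longrightarrow>
      0 < \<xi> \<longrightarrow> \<xi> < 2 * \<delta> / \<epsilon>\<^sup>2 \<longrightarrow>
      1/2 < \<gamma> \<longrightarrow> \<gamma> < 1 \<longrightarrow>
      traveling_wave_coeffs \<alpha> \<epsilon> f g \<longrightarrow>
      linearized_boussinesq_solution \<alpha> \<xi> f g {2 * \<xi> ..< \<delta> / \<epsilon>\<^sup>2} Z Q \<longrightarrow>
      (\<forall>t \<in> {2 * \<xi> <..< \<delta> / \<epsilon>\<^sup>2}.
         energy_norm (proj {k. \<bar>k\<bar> \<noteq> 1} (Z t)) (proj {k. \<bar>k\<bar> \<noteq> 1} (Q t))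
           \<le> C \<alpha> * exp 10 * sqrt (t / \<xi>) * energy_norm (Z (2 * \<xi>)) (Q (2 * \<xi>)) \<and>
         energy_norm (proj {k. \<bar>k\<bar> = 1} (Z t)) (proj {k. \<bar>k\<bar> = 1} (Q t))
           \<le> D \<alpha> \<gamma> * (t / \<xi>) powr \<gamma> * exp 10 * sqrt (t / \<xi>)
             * energy_norm (Z (2 * \<xi>)) (Q (2 * \<xi>)))"
proof -
  \<comment> \<open>The condition on \<alpha> sits inside the existential, so that choice yields a
    total function of \<alpha>, arbitrary for \<alpha> \<le> 1/4.\<close>
  have "\<forall>\<alpha>::real. \<exists>K. 1/4 < \<alpha> \<longrightarrow> 0 \<le> K \<and> (\<forall>\<epsilon> \<delta> \<xi> f g Z Q t. 0 < \<epsilon> \<longrightarrow> \<delta> < 0.1 \<longrightarrow> 0 < \<xi> \<longrightarrow>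
      traveling_wave_coeffs \<alpha> \<epsilon> f g \<longrightarrow>
      linearized_boussinesq_solution \<alpha> \<xi> f g {2 * \<xi>..<\<delta> / \<epsilon>\<^sup>2} Z Q \<longrightarrow> t \<in> {2 * \<xi><..<\<delta> / \<epsilon>\<^sup>2} \<longrightarrow>
      energy_norm (Z t) (Q t) \<le> K * sqrt (t / \<xi>) * energy_norm (Z (2 * \<xi>)) (Q (2 * \<xi>)) \<and>
      finite_energy (Z t) (Q t))"
    (is "\<forall>\<alpha>. \<exists>K. ?P \<alpha> K")
  proof
    fix \<alpha> :: real
    show "\<exists>K. ?P \<alpha> K"
    proof (cases "1/4 < \<alpha>")
      case True
      show ?thesis by (rule uniform_energy_growth[OF True], rule exI) blast
    qed simp
  qed
  then obtain C where C: "\<And>\<alpha>. ?P \<alpha> (C \<alpha>)" by metis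
  \<comment> \<open>The bound \<open>?B\<close> for the whole norm dominates both projections. Since
    \<open>exp 10\<close> and (t / \<xi>)^\<gamma> are at least 1 on this time interval, the same
    \<open>C \<alpha>\<close> serves as both constants.\<close>
  show ?thesis
  proof (rule exI[of _ C], rule exI[of _ "\<lambda>\<alpha> \<gamma>. C \<alpha>"], intro allI impI ballI)
    fix \<alpha> \<epsilon> \<delta> \<xi> \<gamma> :: real and f g Z Q t
    assume asm: "1/4 < \<alpha>" "0 < \<epsilon>" "\<delta> < 0.1" "0 < \<xi>" "1/2 < \<gamma>"
      "traveling_wave_coeffs \<alpha> \<epsilon> f g"
      "linearized_boussinesq_solution \<alpha> \<xi> f g {2 * \<xi>..<\<delta> / \<epsilon>\<^sup>2} Z Q"
      and t: "t \<in> {2 * \<xi><..<\<delta> / \<epsilon>\<^sup>2}"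
    let ?n0 = "energy_norm (Z (2 * \<xi>)) (Q (2 * \<xi>))"
    let ?B = "C \<alpha> * sqrt (t / \<xi>) * ?n0"
    have K: "0 \<le> C \<alpha>" "energy_norm (Z t) (Q t) \<le> ?B" "finite_energy (Z t) (Q t)"
      using C asm t by blast+
    have "1 \<le> t / \<xi>" using t asm(4) by simp
    then have B: "0 \<le> ?B" and pow: "1 \<le> (t / \<xi>) powr \<gamma>"
      using K(1) asm(5) by (auto simp: energy_norm_def infsum_nonneg intro!: ge_one_powr_ge_zero)
    have bound: "energy_norm (proj A (Z t)) (proj A (Q t)) \<le> ?B" for A
      using energy_norm_proj_le[OF K(3)] K(2) by (rule order.trans)
    have exp1: "?B \<le> exp 10 * ?B"
      using B by (intro mult_le_cancel_right1[THEN iffD2]) auto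
    also have "\<dots> \<le> (t / \<xi>) powr \<gamma> * (exp 10 * ?B)"
      using mult_right_mono[OF pow mult_nonneg_nonneg[OF exp_ge_zero B]] by (simp only: mult_1_left)
    finally have exp2: "?B \<le> (t / \<xi>) powr \<gamma> * (exp 10 * ?B)" .
    show "energy_norm (proj {k. \<bar>k\<bar> \<noteq> 1} (Z t)) (proj {k. \<bar>k\<bar> \<noteq> 1} (Q t))
           \<le> C \<alpha> * exp 10 * sqrt (t / \<xi>) * ?n0 \<and>
         energy_norm (proj {k. \<bar>k\<bar> = 1} (Z t)) (proj {k. \<bar>k\<bar> = 1} (Q t))
           \<le> C \<alpha> * (t / \<xi>) powr \<gamma> * exp 10 * sqrt (t / \<xi>) * ?n0"
      using order.trans[OF bound exp1] order.trans[OF bound exp2] by (simp only: mult_ac simp_thms)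
  qed
qed

end
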